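(* Suppose weights $\omega(\nwarrow^{s}\nearrow^{t})$, $s,t\in\mathbb{Z}$, are given, all but finitely many equal to $0$. For every $(k_1,\dots,k_n)\in\mathbb{Z}^n$, the signed generating function of generalized extended arrowed monotone triangles with bottom row $(k_1,\dots,k_n)$ equals $$\prod_{i=1}^n\sum_{s,t\in\mathbb{Z}}\omega(\nwarrow^{s}\nearrow^{t})X_i^{t-s}\prod_{1\le p<q\le n}\left(\sum_{s,t\in\mathbb{Z}}\omega(\nwarrow^{s}\nearrow^{t})E_{k_p}^{t}E_{k_q}^{-s}\right)s_{(k_n,\dots,k_1)}(X_1,\dots,X_n),$$ with the operator product expanded and applied to $(k_1,\dots,k_n)\mapsto s_{(k_n,\dots,k_1)}$ as a function on $\mathbb{Z}^n$ before evaluation.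
   Context: Signed interval for $a,b\in\mathbb{Z}$: $\langle a,b\rangle=([a,b],\emptyset)$ if $a\le b$; $(\emptyset,[b+1,a-1])$ if $b+1\le a-1$; $(\emptyset,\emptyset)$ if $b+1=a$; it is negative when its negative part is nonempty. A generalized extended arrowed monotone triangle is a triangular array $(a_{i,j})_{1\le j\le i\le n}$ of integers, each decorated with a symbol $\nwarrow^{s}\nearrow^{t}$, $s,t\in\mathbb{Z}$, such that for each $a=a_{i,j}$, $i<n$, with $b=a_{i+1,j}$ decorated $\nwarrow^{s_b}\nearrow^{t_b}$ and $c=a_{i+1,j+1}$ decorated $\nwarrow^{s_c}\nearrow^{t_c}$, one has $a\in\langle b+t_b,c-s_c\rangle$. Its sign is $(-1)^N$ with $N$ the number of pairs $(i,j)$, $2\le i\le n$, $j<i$, such that $\langle a_{i,j}+t_{a_{i,j}},a_{i,j+1}-s_{a_{i,j+1}}\rangle$ is negative. With $\alpha(\nwarrow^{s}\nearrow^{t})=t-s$, its weight is $\prod_{p,q}\omega(\nwarrow^{p}\nearrow^{q})^{\#\text{ of such decorations}}\prod_iX_i^{\sum_ja_{i,j}-\sum_ja_{i-1,j}+\sum_j\alpha(\mathrm{decor}(a_{i,j}))}$. $E_x$ is the shift $E_xp(x)=p(x+1)$. Extended Schur polynomial: for $\lambda\in\mathbb{Z}^n$, $s_\lambda=0$ if $\lambda_i-i=\lambda_j-j$ for some $i<j$; else with $\sigma$ such that $\lambda_{\sigma(1)}-\sigma(1)>\dots>\lambda_{\sigma(n)}-\sigma(n)$ and integer $p\ge0$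 with $\lambda_{\sigma(n)}+n-\sigma(n)+p\ge0$, $s_\lambda=\operatorname{sgn}(\sigma)s_\mu\prod X_i^{-p}$, $\mu_i=\lambda_{\sigma(i)}+i-\sigma(i)+p$. *)

theory Defs
  imports "HOL-Combinatorics.Permutations" "HOL-Library.FuncSet"
begin

definition in_sint :: "int \<Rightarrow> int \<Rightarrow> int \<Rightarrow> bool" where
  "in_sint x a b \<longleftrightarrow> (a \<le> x \<and> x \<le> b) \<or> (b + 1 \<le> x \<and> x \<le> a - 1)"

definition neg_sint :: "int \<Rightarrow> int \<Rightarrow> bool" where
  "neg_sint a b \<longleftrightarrow> b + 1 \<le> a - 1"

definition wsupp :: "(int \<Rightarrow> int \<Rightarrow> 'a::zero) \<Rightarrow> (int \<times> int) set" where
  "wsupp w = {(s,t). w s t \<noteq> 0}"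

definition tri_pos :: "nat \<Rightarrow> (nat \<times> nat) set" where
  "tri_pos n = {(i,j). 1 \<le> j \<and> j \<le> i \<and> i \<le> n}"

text \<open>A triangle is a pair (a,d): a i j the entry, d i j = (s,t) its decoration
  (nwarrow^s nearrow^t).  Values outside the triangle are normalised to 0.
  Only decorations of nonzero weight are admitted (all other triangles have weight 0).\<close>
definition gteamt :: "nat \<Rightarrow> (nat \<Rightarrow> int) \<Rightarrow> (int \<times> int) set
    \<Rightarrow> ((nat \<Rightarrow> nat \<Rightarrow> int) \<times> (nat \<Rightarrow> nat \<Rightarrow> int \<times> int)) set" where
  "gteamt n k S = {(a,d).
     (\<forall>i j. (i,j) \<notin> tri_pos n \<longrightarrow> a i j = 0 \<and> d i j = (0,0)) \<and>
     (\<forall>(i,j)\<in>tri_pos n. d i j \<in> S) \<and>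
     (\<forall>j\<in>{1..n}. a n j = k j) \<and>
     (\<forall>i j. 1 \<le> j \<and> j \<le> i \<and> i < n \<longrightarrow>
        in_sint (a i j) (a (Suc i) j + snd (d (Suc i) j))
                        (a (Suc i) (Suc j) - fst (d (Suc i) (Suc j))))}"

definition tri_sign :: "nat \<Rightarrow> (nat \<Rightarrow> nat \<Rightarrow> int) \<Rightarrow> (nat \<Rightarrow> nat \<Rightarrow> int \<times> int) \<Rightarrow> int" where
  "tri_sign n a d = (-1) ^ card {(i,j). 2 \<le> i \<and> i \<le> n \<and> 1 \<le> j \<and> j < i \<and>
        neg_sint (a i j + snd (d i j)) (a i (Suc j) - fst (d i (Suc j)))}"

definition tri_weight :: "(int \<Rightarrow> int \<Rightarrow> 'a::field) \<Rightarrow> nat \<Rightarrow> (nat \<Rightarrow> 'a)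
    \<Rightarrow> (nat \<Rightarrow> nat \<Rightarrow> int) \<Rightarrow> (nat \<Rightarrow> nat \<Rightarrow> int \<times> int) \<Rightarrow> 'a" where
  "tri_weight w n X a d =
     (\<Prod>(i,j)\<in>tri_pos n. w (fst (d i j)) (snd (d i j))) *
     (\<Prod>i=1..n. X i powi ((\<Sum>j=1..i. a i j) - (\<Sum>j=1..i-1. a (i-1) j)
                           + (\<Sum>j=1..i. snd (d i j) - fst (d i j))))"

definition gen_fun :: "(int \<Rightarrow> int \<Rightarrow> 'a::field) \<Rightarrow> nat \<Rightarrow> (nat \<Rightarrow> int) \<Rightarrow> (nat \<Rightarrow> 'a) \<Rightarrow> 'a" where
  "gen_fun w n k X = (\<Sum>(a,d)\<in>gteamt n k (wsupp w). of_int (tri_sign n a d) * tri_weight w n X a d)"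

definition yd_cells :: "nat \<Rightarrow> (nat \<Rightarrow> nat) \<Rightarrow> (nat \<times> nat) set" where
  "yd_cells n mu = {(r,c). 1 \<le> r \<and> r \<le> n \<and> 1 \<le> c \<and> c \<le> mu r}"

definition ssyt :: "nat \<Rightarrow> (nat \<Rightarrow> nat) \<Rightarrow> (nat \<Rightarrow> nat \<Rightarrow> nat) set" where
  "ssyt n mu = {T.
     (\<forall>r c. (r,c) \<notin> yd_cells n mu \<longrightarrow> T r c = 0) \<and>
     (\<forall>(r,c)\<in>yd_cells n mu. 1 \<le> T r c \<and> T r c \<le> n) \<and>
     (\<forall>r c c'. (r,c) \<in> yd_cells n mu \<and> (r,c') \<in> yd_cells n mu \<and> c < c' \<longrightarrow> T r c \<le> T r c') \<and>
     (\<forall>r r' c. (r,c) \<in> yd_cells n mu \<and> (r',c) \<in> yd_cells n mu \<and> r < r' \<longrightarrow> T r c < T r' c)}"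

definition schur :: "nat \<Rightarrow> (nat \<Rightarrow> nat) \<Rightarrow> (nat \<Rightarrow> 'a::comm_ring_1) \<Rightarrow> 'a" where
  "schur n mu X = (\<Sum>T\<in>ssyt n mu. \<Prod>(r,c)\<in>yd_cells n mu. X (T r c))"

text \<open>Extended Schur polynomial for lam in Z^n (indices 1..n); p is chosen minimal.\<close>
definition ext_schur :: "nat \<Rightarrow> (nat \<Rightarrow> int) \<Rightarrow> (nat \<Rightarrow> 'a::field) \<Rightarrow> 'a" where
  "ext_schur n lam X =
    (if \<exists>i j. 1 \<le> i \<and> i < j \<and> j \<le> n \<and> lam i - int i = lam j - int j then 0
     else
       (let \<sigma> = (THE \<sigma>. \<sigma> permutes {1..n} \<and>
                   (\<forall>i j. 1 \<le> i \<and> i < j \<and> j \<le> n \<longrightarrow>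
                        lam (\<sigma> i) - int (\<sigma> i) > lam (\<sigma> j) - int (\<sigma> j)));
            p = max 0 (- (lam (\<sigma> n) + int n - int (\<sigma> n)));
            mu = (\<lambda>i. nat (lam (\<sigma> i) + int i - int (\<sigma> i) + p))
        in of_int (sign \<sigma>) * schur n mu X * (\<Prod>i=1..n. X i powi (- p))))"

definition pairs_lt :: "nat \<Rightarrow> (nat \<times> nat) set" where
  "pairs_lt n = {(p,q). 1 \<le> p \<and> p < q \<and> q \<le> n}"

text \<open>Shift of k_m produced by a choice c of a term (s,t) for each factor (p,q):
  E_{k_p}^t E_{k_q}^{-s}.\<close>
definition shifted :: "nat \<Rightarrow> (nat \<times> nat \<Rightarrow> int \<times> int) \<Rightarrow> (nat \<Rightarrow> int) \<Rightarrow> nat \<Rightarrow> int" where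
  "shifted n c k m = k m + (\<Sum>q\<in>{m<..n}. snd (c (m,q))) - (\<Sum>p\<in>{1..<m}. fst (c (p,m)))"

text \<open>(prod_{p<q} sum_{s,t} w(s,t) E_{k_p}^t E_{k_q}^{-s}) applied to f, expanded.\<close>
definition op_apply :: "(int \<Rightarrow> int \<Rightarrow> 'a::comm_ring_1) \<Rightarrow> nat \<Rightarrow> ((nat \<Rightarrow> int) \<Rightarrow> 'a)
    \<Rightarrow> (nat \<Rightarrow> int) \<Rightarrow> 'a" where
  "op_apply w n f k = (\<Sum>c\<in>Pi\<^sub>E (pairs_lt n) (\<lambda>_. wsupp w).
      (\<Prod>pq\<in>pairs_lt n. w (fst (c pq)) (snd (c pq))) * f (shifted n c k))"

end

(*
For distinct values X_1, ..., X_n the generating function is a bialternant: multiplied by the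
Vandermonde product it equals the alternating sum over permutations sigma of
  prod_i X_sigma(i)^(k_i + i - 1) * prod_(p <= q) W(X_sigma(p), X_sigma(q)),
where W(x,y) = sum_(s,t) w(s,t) x^t y^(-s). This follows by induction on n: the sums over the
signed intervals of the bottom row are geometric and telescope to their end points, most choices
of end points cancel under alternation because W(x,y) W(y,x) is symmetric, and the remaining n
choices insert X_n into the permutation. For trivial weights the same identity is the Jacobi
formula for Schur polynomials, extended to all integer vectors; hence expanding the product over
p < q exhibits the shift operators. Both sides are Laurent polynomials, so the case of
coinciding X_i follows by perturbing them to distinct power series and taking constant terms.
*)
theory Submission
  imports Defs "HOL-Computational_Algebra.Formal_Power_Series"
begin

text \<open>The geometric sums over the intervals of row \<open>n + 1\<close> have denominators
  X_(n+1) - X_i, one per interval, and these are exactly the factors by which the Vandermonde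
  product grows from \<open>n\<close> to \<open>n + 1\<close>. Keeping the product on the left
  therefore avoids every division, and the bialternant identity holds in any commutative ring with a
  family of units. Where values coincide the factor is 0; a finite field may not even contain enough
  elements to move them apart, so the perturbation has to leave the field. Power series over it form
  an integral domain with enough distinct units. Jacobi's formula needs no determinant calculus of
  its own: with the single decoration (0,0) of weight 1 and a weakly increasing bottom row, the
  triangles are Gelfand-Tsetlin patterns, which encode semistandard tableaux. The signed intervals
  then continue the same alternating sum to all integer bottom rows, and \<open>ext_schur\<close>
  follows the same straightening rule. The factors W(x,x) come from the one position of each row at
  which no interval end point is taken.\<close>

definition sint :: "int \<Rightarrow> int \<Rightarrow> int set" where
  "sint a b = {x. in_sint x a b}"

definition ssgn :: "int \<Rightarrow> int \<Rightarrow> int" where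
  "ssgn a b = (if neg_sint a b then -1 else 1)"

lemma sint_eq: "sint a b = (if neg_sint a b then {b+1..a-1} else {a..b})"
  by (auto simp: sint_def in_sint_def neg_sint_def)

lemma finite_sint [simp]: "finite (sint a b)"
  by (simp add: sint_eq)

text \<open>\<open>P i e\<close> stands for \<open>X i powi e\<close>; abstracting it lets the same recursion live in a ring of
  power series, where powers of units play this role.\<close>

fun ggf :: "(int \<times> int) set \<Rightarrow> (int \<Rightarrow> int \<Rightarrow> 'b::comm_ring_1) \<Rightarrow> (nat \<Rightarrow> int \<Rightarrow> 'b)
    \<Rightarrow> nat \<Rightarrow> (nat \<Rightarrow> int) \<Rightarrow> 'b" where
  "ggf S w P 0 k = 1"
| "ggf S w P (Suc n) k =
    (\<Sum>d\<in>PiE {1..Suc n} (\<lambda>_. S). (\<Prod>j=1..Suc n. w (fst (d j)) (snd (d j))) *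
      (\<Sum>l\<in>PiE {1..n} (\<lambda>j. sint (k j + snd (d j)) (k (Suc j) - fst (d (Suc j)))).
        (\<Prod>j=1..n. of_int (ssgn (k j + snd (d j)) (k (Suc j) - fst (d (Suc j))))) *
        P (Suc n) ((\<Sum>j=1..Suc n. k j) - (\<Sum>j=1..n. l j)
          + (\<Sum>j=1..Suc n. snd (d j) - fst (d j))) *
        ggf S w P n l))"

subsection \<open>Alternating sums over permutations\<close>

definition alt_sum :: "nat \<Rightarrow> ((nat \<Rightarrow> nat) \<Rightarrow> 'b) \<Rightarrow> 'b::comm_ring_1" where
  "alt_sum n f = (\<Sum>\<sigma> | \<sigma> permutes {1..n}. of_int (sign \<sigma>) * f \<sigma>)"

lemma alt_sum_cong:
  assumes "\<And>\<sigma>. \<sigma> permutes {1..n} \<Longrightarrow> f \<sigma> = g \<sigma>"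
  shows "alt_sum n f = alt_sum n g"
  unfolding alt_sum_def using assms by (intro sum.cong) auto

lemma alt_sum_mult_left: "alt_sum n (\<lambda>\<sigma>. c * f \<sigma>) = c * alt_sum n f"
  unfolding alt_sum_def sum_distrib_left by (intro sum.cong) (auto simp: mult_ac)

lemma alt_sum_sum: "alt_sum n (\<lambda>\<sigma>. \<Sum>x\<in>A. f x \<sigma>) = (\<Sum>x\<in>A. alt_sum n (f x))"
  unfolding alt_sum_def sum_distrib_left by (rule sum.swap)

lemma sign_comp_transpose:
  assumes "\<sigma> permutes {1..n::nat}" "a \<noteq> b"
  shows "sign (\<sigma> \<circ> transpose a b) = - sign \<sigma>"
proof -
  have "permutation \<sigma>" using assms(1) by (meson finite_atLeastAtMost permutation_permutes)
  then show ?thesis using assms(2)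
    by (subst sign_compose) (auto simp: sign_swap_id permutation_swap_id)
qed

text \<open>Pairing even with odd permutations keeps this valid in characteristic 2.\<close>

lemma alt_sum_eq_0:
  assumes ab: "a \<in> {1..n}" "b \<in> {1..n}" "a \<noteq> b"
    and f: "\<And>\<sigma>. \<sigma> permutes {1..n} \<Longrightarrow> f (\<sigma> \<circ> transpose a b) = f \<sigma>"
  shows "alt_sum n f = 0"
proof -
  let ?E = "{\<sigma>. \<sigma> permutes {1..n} \<and> sign \<sigma> = 1}"
  let ?O = "{\<sigma>. \<sigma> permutes {1..n} \<and> sign \<sigma> = -1}"
  have U: "{\<sigma>. \<sigma> permutes {1..n}} = ?E \<union> ?O"
    using sign_cases by auto
  have "finite {\<sigma>. \<sigma> permutes {1..n}}" by (simp add: finite_permutations)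
  then have fin: "finite ?E" "finite ?O" by (rule rev_finite_subset, blast)+
  have Int_sgn: "?E \<inter> ?O = {}" by auto
  have t: "transpose a b permutes {1..n}"
    using ab by (intro permutes_swap_id) auto
  have sgn: "\<sigma> \<circ> transpose a b permutes {1..n} \<and> sign (\<sigma> \<circ> transpose a b) = - sign \<sigma>"
    if "\<sigma> permutes {1..n}" for \<sigma>
    using permutes_compose[OF t that] sign_comp_transpose[OF that ab(3)] by blast
  have inv: "\<sigma> \<circ> transpose a b \<circ> transpose a b = \<sigma>" for \<sigma> :: "nat \<Rightarrow> nat"
    by (simp add: comp_assoc)
  have "sum f ?O = sum f ?E"
    by (rule sum.reindex_bij_witness[where i = "\<lambda>\<sigma>. \<sigma> \<circ> transpose a b" and j = "\<lambda>\<sigma>. \<sigma> \<circ> transpose a b"])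
       (simp_all only: mem_Collect_eq inv sgn f simp_thms minus_minus)
  moreover have "alt_sum n f = sum f ?E - sum f ?O"
    unfolding alt_sum_def U sum.union_disjoint[OF fin Int_sgn] by (simp add: sum_negf)
  ultimately show ?thesis by simp
qed

text \<open>\<open>ins n m\<close> sends \<open>m\<close> to \<open>Suc n\<close> and keeps the other positions in order, so that
  \<open>\<tau> \<circ> ins n m\<close> is the word of \<open>\<tau>\<close> with \<open>Suc n\<close> inserted at position \<open>m\<close>.\<close>

definition ins :: "nat \<Rightarrow> nat \<Rightarrow> nat \<Rightarrow> nat" where
  "ins n m j = (if j < m \<or> j > Suc n then j else if j = m then Suc n else j - 1)"

lemma ins_Suc: "m \<le> n \<Longrightarrow> ins n m = ins n (Suc m) \<circ> transpose m (Suc m)"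
  by (rule ext) (auto simp: ins_def transpose_def)

text \<open>By \<open>ins_Suc\<close>, lowering the insertion position by one costs one adjacent
  transposition, starting from the identity at position \<open>Suc n\<close>.\<close>

lemma ins_props:
  assumes "m \<in> {1..Suc n}"
  shows "ins n m permutes {1..Suc n} \<and> sign (ins n m) = (-1) ^ (Suc n - m)"
proof -
  have "m \<le> Suc n \<Longrightarrow> 1 \<le> m \<Longrightarrow> ?thesis"
  proof (induction rule: inc_induct)
    case base
    have "ins n (Suc n) = id" by (auto simp: ins_def fun_eq_iff)
    then show ?case by (metis permutes_id sign_id diff_self_eq_0 power_0)
  next
    case (step m)
    then have IH: "ins n (Suc m) permutes {1..Suc n}" "sign (ins n (Suc m)) = (-1) ^ (Suc n - Suc m)"
      by auto
    have e: "ins n m = ins n (Suc m) \<circ> transpose m (Suc m)" using step by (intro ins_Suc) auto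
    have "transpose m (Suc m) permutes {1..Suc n}" using step by (intro permutes_swap_id) auto
    then have "ins n m permutes {1..Suc n}" unfolding e using IH by (intro permutes_compose)
    moreover have "sign (ins n m) = (-1) ^ (Suc n - m)"
      unfolding e using sign_comp_transpose[OF IH(1), of m "Suc m"] IH(2) step(2)
      by (simp add: Suc_diff_le)
    ultimately show ?case by simp
  qed
  with assms show ?thesis by auto
qed

text \<open>Each permutation of \<open>Suc n\<close> letters arises exactly once from inserting the
  largest letter into the word of a smaller permutation. For determinants this is the Laplace
  expansion along the last row.\<close>

lemma alt_sum_Suc:
  "alt_sum (Suc n) f = (\<Sum>m=1..Suc n. (-1) ^ (Suc n - m) * alt_sum n (\<lambda>\<tau>. f (\<tau> \<circ> ins n m)))"
proof -
  let ?D = "{1..Suc n} \<times> {\<tau>. \<tau> permutes {1..n}}"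
  have p: "\<tau> permutes {1..Suc n}" if "\<tau> permutes {1..n}" for \<tau>
    using that by (rule permutes_subset) auto
  have perm: "permutation \<tau>" if "\<tau> permutes {1..n}" for \<tau> and n :: nat
    using that by (meson finite_atLeastAtMost permutation_permutes)
  have fix_N: "\<tau> (Suc n) = Suc n" if "\<tau> permutes {1..n}" for \<tau>
    using that by (simp add: permutes_def)
  have "alt_sum (Suc n) f =
    (\<Sum>(m,\<tau>)\<in>?D. of_int (sign (\<tau> \<circ> ins n m)) * f (\<tau> \<circ> ins n m))"
    unfolding alt_sum_def
  proof (rule sum.reindex_bij_witness[symmetric, where i = "\<lambda>\<sigma>. (inv \<sigma> (Suc n), \<sigma> \<circ> inv (ins n (inv \<sigma> (Suc n))))"
        and j = "\<lambda>(m,\<tau>). \<tau> \<circ> ins n m"], goal_cases)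
    case (1 x)
    then obtain m \<tau> where x: "x = (m,\<tau>)" "m \<in> {1..Suc n}" "\<tau> permutes {1..n}" by auto
    have im: "ins n m permutes {1..Suc n}" using ins_props x by auto
    then have t: "\<tau> \<circ> ins n m permutes {1..Suc n}" using p x by (intro permutes_compose)
    have "(\<tau> \<circ> ins n m) m = Suc n" using x fix_N by (auto simp: ins_def)
    then have "inv (\<tau> \<circ> ins n m) (Suc n) = m" using permutes_inverses(2)[OF t] by metis
    moreover have "\<tau> \<circ> ins n m \<circ> inv (ins n m) = \<tau>"
      using permutes_inv_o(1)[OF im] by (simp add: o_assoc[symmetric])
    ultimately show ?case using x by simp
  next
    case (2 x)
    then show ?case using p ins_props by (auto intro!: permutes_compose)
  next
    case (3 \<sigma>)
    then have s: "\<sigma> permutes {1..Suc n}" by simp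
    have "inv \<sigma> (Suc n) \<in> {1..Suc n}" using permutes_in_image[OF permutes_inv[OF s], of "Suc n"] by simp
    then have im: "ins n (inv \<sigma> (Suc n)) permutes {1..Suc n}" using ins_props by auto
    then show ?case using permutes_inv_o(2)[OF im] by (simp add: o_assoc[symmetric])
  next
    case (4 \<sigma>)
    then have s: "\<sigma> permutes {1..Suc n}" by simp
    let ?m = "inv \<sigma> (Suc n)" and ?\<tau> = "\<sigma> \<circ> inv (ins n (inv \<sigma> (Suc n)))"
    have m: "?m \<in> {1..Suc n}" using permutes_in_image[OF permutes_inv[OF s], of "Suc n"] by simp
    then have im: "ins n ?m permutes {1..Suc n}" using ins_props by auto
    have t: "?\<tau> permutes {1..Suc n}" using s permutes_inv[OF im] by (intro permutes_compose)
    have "ins n ?m ?m = Suc n" using m by (auto simp: ins_def)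
    then have "inv (ins n ?m) (Suc n) = ?m" using permutes_inverses(2)[OF im] by metis
    \<comment> \<open>Removing the largest letter from its position leaves a map fixing
      \<open>Suc n\<close>, hence a permutation of the first \<open>n\<close> letters.\<close>
    then have "?\<tau> (Suc n) = Suc n" using permutes_inverses(1)[OF s] by simp
    then have "?\<tau> permutes {1..n}" 
      by (intro permutes_superset[OF t]) (metis Diff_iff atLeastAtMost_iff le_Suc_eq)
    then show ?case using m by auto
  next
    case (5 x)
    then show ?case by auto
  qed
  also have "\<dots> = (\<Sum>(m,\<tau>)\<in>?D. (-1) ^ (Suc n - m) * (of_int (sign \<tau>) * f (\<tau> \<circ> ins n m)))"
  proof (rule sum.cong, goal_cases)
    case (2 x)
    then obtain m \<tau> where x: "x = (m,\<tau>)" "m \<in> {1..Suc n}" "\<tau> permutes {1..n}" by auto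
    have "sign (\<tau> \<circ> ins n m) = sign \<tau> * (-1) ^ (Suc n - m)"
      using x ins_props[of m n] by (auto simp: sign_compose perm)
    then show ?case using x by (simp add: mult_ac)
  qed simp
  finally show ?thesis
    unfolding alt_sum_def sum_distrib_left by (simp add: sum.cartesian_product)
qed

subsection \<open>The bialternant formula\<close>

definition vand :: "(nat \<Rightarrow> int \<Rightarrow> 'b::comm_ring_1) \<Rightarrow> nat \<Rightarrow> 'b" where
  "vand P n = (\<Prod>j=1..n. \<Prod>i=1..<j. P j 1 - P i 1)"

lemma vand_Suc: "vand P (Suc n) = vand P n * (\<Prod>i=1..n. P (Suc n) 1 - P i 1)"
  by (simp add: vand_def atLeastLessThanSuc_atLeastAtMost mult_ac)

text \<open>The value W(X_a, X_b). It is also the symbol of the factor (p,q) of the operator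
  product: the factor by which it multiplies a monomial with X_a at position p and X_b at position
  q.\<close>

definition opW :: "(int \<times> int) set \<Rightarrow> (int \<Rightarrow> int \<Rightarrow> 'b::comm_ring_1) \<Rightarrow> (nat \<Rightarrow> int \<Rightarrow> 'b)
    \<Rightarrow> nat \<Rightarrow> nat \<Rightarrow> 'b" where
  "opW S w P a b = (\<Sum>(s,t)\<in>S. w s t * (P a t * P b (- s)))"

section \<open>Integer powers of units and geometric sums over signed intervals\<close>

text \<open>The two axioms make each \<open>P i\<close> a homomorphism from the integers to the
  units, so \<open>P i (- e)\<close> serves as the inverse of \<open>P i e\<close> without a
  division operation.\<close>

locale int_powers =
  fixes P :: "nat \<Rightarrow> int \<Rightarrow> 'b::comm_ring_1"
  assumes P_0 [simp]: "P i 0 = 1"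
    and P_add: "P i (a + b) = P i a * P i b"
begin

lemma P_sum: "P i (\<Sum>x\<in>A. f x) = (\<Prod>x\<in>A. P i (f x))"
  by (induction A rule: infinite_finite_induct) (auto simp: P_add)

lemma geometric_telescope:
  assumes "c \<le> d + 1"
  shows "(P b 1 - P a 1) * (\<Sum>x\<in>{c..d}. P a x * P b (- x))
       = P a c * P b (1 - c) - P a (d + 1) * P b (- d)"
proof -
  \<comment> \<open>The induction starts at the empty sum, where both end point terms agree.\<close>
  have "c - 1 \<le> d" using assms by simp
  then show ?thesis
  proof (induction d rule: int_ge_induct)
    case base
    then show ?case by simp
  next
    case (step d)
    then have "{c..d + 1} = insert (d + 1) {c..d}" by auto
    moreover have "P b (- d) = P b 1 * P b (- (d + 1))" 
      by (simp flip: P_add)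
    moreover have "P a (d + 1 + 1) = P a 1 * P a (d + 1)"
      by (simp flip: P_add add: add_ac)
    ultimately show ?case using step by (simp add: algebra_simps)
  qed
qed

text \<open>The convention for signed intervals is the one that makes the end point formula uniform:
  summing over the complementary open range with a minus sign exchanges the two end point
  terms.\<close>

lemma geometric:
  "(P b 1 - P a 1) * (\<Sum>x\<in>sint c d. of_int (ssgn c d) * (P a x * P b (- x)))
     = P a c * P b (1 - c) - P a (d + 1) * P b (- d)"
proof (cases "neg_sint c d")
  case True
  then show ?thesis
    using geometric_telescope[of "d + 1" "c - 1" b a]
    by (simp add: sint_eq ssgn_def neg_sint_def sum_negf)
next
  case False
  then show ?thesis
    using geometric_telescope[of c d b a]
    by (simp add: sint_eq ssgn_def neg_sint_def)
qed

end

text \<open>The pairs with p = q carry the symmetric product of the W(X_i, X_i), those with p < q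
  the operator factors.\<close>

definition pairs_le :: "nat \<Rightarrow> (nat \<times> nat) set" where
  "pairs_le n = {(p,q). 1 \<le> p \<and> p \<le> q \<and> q \<le> n}"

lemma finite_pairs_le [simp]: "finite (pairs_le n)"
  by (rule finite_subset[of _ "{1..n} \<times> {1..n}"]) (auto simp: pairs_le_def)

context int_powers
begin

text \<open>Geometric summation over the \<open>i\<close>-th signed interval leaves one term for each end point.
  With \<open>B\<close> the set of those \<open>i\<close> for which the right end point is chosen, \<open>slot\<close> is the resulting
  factor of position \<open>j\<close> of the bottom row, summed over its decoration.\<close>

definition slot :: "(int \<times> int) set \<Rightarrow> (int \<Rightarrow> int \<Rightarrow> 'b) \<Rightarrow> (nat \<Rightarrow> int) \<Rightarrow> nat
    \<Rightarrow> nat set \<Rightarrow> (nat \<Rightarrow> nat) \<Rightarrow> nat \<Rightarrow> 'b" where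
  "slot S w k n B \<tau> j = (\<Sum>x\<in>S. w (fst x) (snd x) * P (Suc n) (k j + (snd x - fst x)) *
     (if j \<in> {1..n} - B then P (\<tau> j) (k j + snd x) * P (Suc n) (1 - (k j + snd x)) else 1) *
     (if j \<in> Suc ` B then P (\<tau> (j - 1)) (k j - fst x + 1) * P (Suc n) (- (k j - fst x)) else 1))"

definition slots :: "(int \<times> int) set \<Rightarrow> (int \<Rightarrow> int \<Rightarrow> 'b) \<Rightarrow> (nat \<Rightarrow> int) \<Rightarrow> nat
    \<Rightarrow> nat set \<Rightarrow> (nat \<Rightarrow> nat) \<Rightarrow> 'b" where
  "slots S w k n B \<tau> = (\<Prod>(p,q)\<in>pairs_le n. opW S w P (\<tau> p) (\<tau> q)) *
     (\<Prod>i=1..n. P (\<tau> i) (int i - 1)) * (\<Prod>j=1..Suc n. slot S w k n B \<tau> j)"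

text \<open>The left end of interval \<open>i\<close> involves only the decoration at position
  \<open>i\<close>, the right end only the one at \<open>Suc i\<close>. Once the end points are
  chosen, the summand is a product over positions, and the sum over all decorations of the row
  factors.\<close>

lemma sum_rows_eq_slots:
  fixes \<tau> :: "nat \<Rightarrow> nat" and n :: nat and k :: "nat \<Rightarrow> int"
  defines "L \<equiv> \<lambda>d i. P (\<tau> i) (k i + snd (d i)) * P (Suc n) (1 - (k i + snd (d i)))"
    and "R \<equiv> \<lambda>d i. P (\<tau> i) (k (Suc i) - fst (d (Suc i)) + 1) * P (Suc n) (- (k (Suc i) - fst (d (Suc i))))"
  assumes S: "finite S" and B: "B \<subseteq> {1..n}"
  shows "(\<Sum>d\<in>PiE {1..Suc n} (\<lambda>_. S). (\<Prod>j=1..Suc n. w (fst (d j)) (snd (d j))) *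
           P (Suc n) ((\<Sum>j=1..Suc n. k j) + (\<Sum>j=1..Suc n. snd (d j) - fst (d j))) *
           ((\<Prod>i\<in>B. R d i) * (\<Prod>i\<in>{1..n} - B. L d i)))
       = (\<Prod>j=1..Suc n. slot S w k n B \<tau> j)"
proof -
  \<comment> \<open>The right end of interval \<open>i\<close> is booked at position
    \<open>j = Suc i\<close>, hence the image of \<open>B\<close> under \<open>Suc\<close>.\<close>
  have R: "(\<Prod>i\<in>B. R d i) = (\<Prod>j=1..Suc n. if j \<in> Suc ` B then
      P (\<tau> (j - 1)) (k j - fst (d j) + 1) * P (Suc n) (- (k j - fst (d j))) else 1)" for d
  proof -
    have "{1..Suc n} \<inter> Suc ` B = Suc ` B" using B by auto
    moreover have "(\<Prod>i\<in>B. R d i) = (\<Prod>j\<in>Suc ` B. P (\<tau> (j - 1)) (k j - fst (d j) + 1) * P (Suc n) (- (k j - fst (d j))))"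
      by (simp add: prod.reindex R_def)
    ultimately show ?thesis by (simp flip: prod.inter_restrict del: prod.cl_ivl_Suc)
  qed
  have L: "(\<Prod>i\<in>{1..n} - B. L d i) = (\<Prod>j=1..Suc n. if j \<in> {1..n} - B then
      P (\<tau> j) (k j + snd (d j)) * P (Suc n) (1 - (k j + snd (d j))) else 1)" for d
  proof -
    have "{1..Suc n} \<inter> ({1..n} - B) = {1..n} - B" by auto
    then show ?thesis
      by (simp only: L_def flip: prod.inter_restrict[OF finite_atLeastAtMost])
  qed
  show ?thesis
    unfolding slot_def L R sum.distrib[symmetric] P_sum prod.distrib[symmetric]
    by (subst prod_sum_PiE) (auto simp: S mult_ac simp del: prod.cl_ivl_Suc intro!: sum.cong prod.cong)
qed

section \<open>Expanding one row over the choices of interval end points\<close>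

text \<open>With the induction hypothesis inserted for the row above, the entry of each interval
  occurs only in a geometric progression with ratio X_(tau i) / X_(n+1), so the sum over that row is
  a product of \<open>n\<close> geometric sums.\<close>

lemma vand_ggf_Suc:
  assumes S: "finite S"
    and IH: "\<And>l. vand P n * ggf S w P n l = alt_sum n (\<lambda>\<sigma>. (\<Prod>i=1..n. P (\<sigma> i) (l i + int i - 1)) *
          (\<Prod>(p,q)\<in>pairs_le n. opW S w P (\<sigma> p) (\<sigma> q)))"
  shows "vand P (Suc n) * ggf S w P (Suc n) k =
     (\<Sum>B\<in>Pow {1..n}. (-1) ^ card B * alt_sum n (slots S w k n B))"
proof -
  let ?N = "Suc n"
  let ?D = "PiE {1..Suc n} (\<lambda>_. S)"
  define E where "E = (\<lambda>d::nat \<Rightarrow> int \<times> int. (\<Sum>j=1..Suc n. k j) + (\<Sum>j=1..Suc n. snd (d j) - fst (d j)))"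
  define wt where "wt = (\<lambda>d::nat \<Rightarrow> int \<times> int. \<Prod>j=1..Suc n. w (fst (d j)) (snd (d j)))"
  define lo where "lo = (\<lambda>d::nat \<Rightarrow> int \<times> int. \<lambda>j. k j + snd (d j))"
  define hi where "hi = (\<lambda>d::nat \<Rightarrow> int \<times> int. \<lambda>j. k (Suc j) - fst (d (Suc j)))"
  define LL where "LL = (\<lambda>d. PiE {1..n} (\<lambda>j. sint (lo d j) (hi d j)))"
  define WW where "WW = (\<lambda>\<tau>::nat \<Rightarrow> nat. (\<Prod>(p,q)\<in>pairs_le n. opW S w P (\<tau> p) (\<tau> q)) *
     (\<Prod>i=1..n. P (\<tau> i) (int i - 1)))"
  define g where "g = (\<lambda>d \<tau> i x. (P ?N 1 - P (\<tau> i) 1) * (of_int (ssgn (lo d i) (hi d i)) * (P (\<tau> i) x * P ?N (- x))))"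
  define L where "L = (\<lambda>d \<tau> i. P (\<tau> i) (lo d i) * P ?N (1 - lo d i))"
  define R where "R = (\<lambda>d \<tau> i. P (\<tau> i) (hi d i + 1) * P ?N (- hi d i))"
  have row: "(\<Prod>i=1..n. P ?N 1 - P i 1) * ((\<Prod>j=1..n. of_int (ssgn (lo d j) (hi d j))) *
        P ?N ((\<Sum>j=1..Suc n. k j) - (\<Sum>j=1..n. l j) + (\<Sum>j=1..Suc n. snd (d j) - fst (d j)))
        * (vand P n * ggf S w P n l))
      = alt_sum n (\<lambda>\<tau>. WW \<tau> * P ?N (E d) * (\<Prod>i=1..n. g d \<tau> i (l i)))" for d l
  proof -
    have "(\<Sum>j=1..Suc n. k j) - (\<Sum>j=1..n. l j) + (\<Sum>j=1..Suc n. snd (d j) - fst (d j))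
        = E d + (\<Sum>j=1..n. - l j)"
      unfolding E_def sum_negf by simp
    then have e: "P ?N ((\<Sum>j=1..Suc n. k j) - (\<Sum>j=1..n. l j) + (\<Sum>j=1..Suc n. snd (d j) - fst (d j)))
        = P ?N (E d) * (\<Prod>i=1..n. P ?N (- l i))"
      by (simp only: P_add P_sum)
    show ?thesis
      unfolding IH alt_sum_mult_left[symmetric] e
    proof (rule alt_sum_cong)
      fix \<tau> assume t: "\<tau> permutes {1..n}"
      \<comment> \<open>The new Vandermonde factors are symmetric in the old variables, so they may
        be rearranged until interval \<open>i\<close> receives the one for its own variable.\<close>
      have "(\<Prod>i=1..n. P ?N 1 - P i 1) = (\<Prod>i=1..n. P ?N 1 - P (\<tau> i) 1)"
        using prod.permute[OF t, of "\<lambda>i. P ?N 1 - P i 1"] by (simp add: o_def)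
      moreover have "(\<Prod>i=1..n. P (\<tau> i) (l i + int i - 1)) = (\<Prod>i=1..n. P (\<tau> i) (l i)) * (\<Prod>i=1..n. P (\<tau> i) (int i - 1))"
        unfolding prod.distrib[symmetric] P_add[symmetric] by (simp add: algebra_simps)
      moreover have "(\<Prod>i=1..n. g d \<tau> i (l i)) = (\<Prod>i=1..n. P ?N 1 - P (\<tau> i) 1) *
          ((\<Prod>j=1..n. of_int (ssgn (lo d j) (hi d j))) * ((\<Prod>i=1..n. P (\<tau> i) (l i)) * (\<Prod>i=1..n. P ?N (- l i))))"
        by (simp only: g_def prod.distrib)
      ultimately show "(\<Prod>i=1..n. P ?N 1 - P i 1) *
           ((\<Prod>j=1..n. of_int (ssgn (lo d j) (hi d j))) *
            (P ?N (E d) * (\<Prod>i=1..n. P ?N (- l i))) *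
            ((\<Prod>i=1..n. P (\<tau> i) (l i + int i - 1)) * (\<Prod>(p,q)\<in>pairs_le n. opW S w P (\<tau> p) (\<tau> q)))) =
          WW \<tau> * P ?N (E d) * (\<Prod>i=1..n. g d \<tau> i (l i))"
        by (simp only: WW_def mult_ac)
    qed
  qed
  have expand: "(\<Sum>l\<in>LL d. \<Prod>i=1..n. g d \<tau> i (l i)) =
      (\<Sum>B\<in>Pow {1..n}. (-1) ^ card B * ((\<Prod>i\<in>B. R d \<tau> i) * (\<Prod>i\<in>{1..n} - B. L d \<tau> i)))" for d \<tau>
  proof -
    have "(\<Sum>l\<in>LL d. \<Prod>i=1..n. g d \<tau> i (l i)) = (\<Prod>i=1..n. \<Sum>x\<in>sint (lo d i) (hi d i). g d \<tau> i x)"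
      unfolding LL_def by (rule prod_sum_PiE[symmetric]) auto
    also have "\<dots> = (\<Prod>i=1..n. - R d \<tau> i + L d \<tau> i)"
    proof (rule prod.cong[OF refl])
      fix i
      have "(\<Sum>x\<in>sint (lo d i) (hi d i). g d \<tau> i x) = (P ?N 1 - P (\<tau> i) 1) *
          (\<Sum>x\<in>sint (lo d i) (hi d i). of_int (ssgn (lo d i) (hi d i)) * (P (\<tau> i) x * P ?N (- x)))"
        unfolding g_def by (rule sum_distrib_left[symmetric])
      then show "(\<Sum>x\<in>sint (lo d i) (hi d i). g d \<tau> i x) = - R d \<tau> i + L d \<tau> i"
        unfolding geometric by (simp add: L_def R_def)
    qed
    \<comment> \<open>Multiplying out: \<open>B\<close> collects the factors from which the right
      end, with its minus sign, is taken.\<close>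
    also have "\<dots> = (\<Sum>B\<in>Pow {1..n}. (\<Prod>i\<in>B. - R d \<tau> i) * (\<Prod>i\<in>{1..n} - B. L d \<tau> i))"
      by (rule prod_add) simp
    finally show ?thesis by (simp add: prod_uminus mult_ac)
  qed
  have "vand P ?N * ggf S w P ?N k =
    (\<Sum>d\<in>?D. \<Sum>l\<in>LL d. wt d * ((\<Prod>i=1..n. P ?N 1 - P i 1) * ((\<Prod>j=1..n. of_int (ssgn (lo d j) (hi d j))) *
        P ?N ((\<Sum>j=1..Suc n. k j) - (\<Sum>j=1..n. l j) + (\<Sum>j=1..Suc n. snd (d j) - fst (d j)))
        * (vand P n * ggf S w P n l))))"
    unfolding vand_Suc ggf.simps sum_distrib_left LL_def lo_def hi_def wt_def
    by (simp only: mult_ac)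
  also have "\<dots> = (\<Sum>d\<in>?D. \<Sum>l\<in>LL d. alt_sum n (\<lambda>\<tau>. wt d * (WW \<tau> * P ?N (E d) * (\<Prod>i=1..n. g d \<tau> i (l i)))))"
    unfolding row alt_sum_mult_left ..
  also have "\<dots> = alt_sum n (\<lambda>\<tau>. \<Sum>d\<in>?D. wt d * (WW \<tau> * P ?N (E d) * (\<Sum>l\<in>LL d. \<Prod>i=1..n. g d \<tau> i (l i))))"
    unfolding alt_sum_sum sum_distrib_left ..
  also have "\<dots> = alt_sum n (\<lambda>\<tau>. \<Sum>B\<in>Pow {1..n}. (-1) ^ card B * slots S w k n B \<tau>)"
  proof (rule alt_sum_cong)
    fix \<tau>
    have "(\<Sum>d\<in>?D. wt d * (WW \<tau> * P ?N (E d) * (\<Sum>l\<in>LL d. \<Prod>i=1..n. g d \<tau> i (l i))))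
      = (\<Sum>B\<in>Pow {1..n}. (-1) ^ card B * (WW \<tau> * (\<Sum>d\<in>?D. wt d * P ?N (E d) *
            ((\<Prod>i\<in>B. R d \<tau> i) * (\<Prod>i\<in>{1..n} - B. L d \<tau> i)))))"
      unfolding expand sum_distrib_left by (subst sum.swap) (simp only: mult_ac)
    also have "\<dots> = (\<Sum>B\<in>Pow {1..n}. (-1) ^ card B * slots S w k n B \<tau>)"
    proof (rule sum.cong, goal_cases)
      case (2 B)
      then have "(\<Sum>d\<in>?D. wt d * P ?N (E d) * ((\<Prod>i\<in>B. R d \<tau> i) * (\<Prod>i\<in>{1..n} - B. L d \<tau> i)))
          = (\<Prod>j=1..Suc n. slot S w k n B \<tau> j)"
        unfolding wt_def E_def R_def L_def lo_def hi_def
        by (intro sum_rows_eq_slots S) auto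
      then show ?case by (simp only: slots_def WW_def)
    qed simp
    finally show "(\<Sum>d\<in>?D. wt d * (WW \<tau> * P ?N (E d) * (\<Sum>l\<in>LL d. \<Prod>i=1..n. g d \<tau> i (l i))))
      = (\<Sum>B\<in>Pow {1..n}. (-1) ^ card B * slots S w k n B \<tau>)" .
  qed
  finally show ?thesis unfolding alt_sum_sum alt_sum_mult_left .
qed


text \<open>The two choices meeting at position \<open>Suc a\<close> contribute \<open>opW (\<tau> (Suc a)) (\<tau> a)\<close>, which together
  with \<open>opW (\<tau> a) (\<tau> (Suc a))\<close> is symmetric under exchanging the two variables.\<close>

lemma alt_sum_slots_eq_0:
  assumes B: "B \<subseteq> {1..n}" and a: "a \<in> B" "Suc a \<notin> B" "Suc a \<le> n"
  shows "alt_sum n (slots S w k n B) = 0"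
proof (rule alt_sum_eq_0)
  show "a \<in> {1..n}" "Suc a \<in> {1..n}" "a \<noteq> Suc a" using B a by auto
next
  fix \<tau> :: "nat \<Rightarrow> nat" assume "\<tau> permutes {1..n}"
  let ?t = "transpose a (Suc a)"
  have a1: "1 \<le> a" using B a by auto
  \<comment> \<open>All factors affected individually by exchanging the variables at positions
    \<open>a\<close> and \<open>Suc a\<close>.\<close>
  define mid where "mid = (\<lambda>\<tau>. opW S w P (\<tau> a) (\<tau> (Suc a)) * (P (\<tau> a) (int a - 1) * P (\<tau> (Suc a)) (int a)) *
      slot S w k n B \<tau> (Suc a))"
  have mid: "mid \<tau> = P (Suc n) (1 - k (Suc a)) * (opW S w P (\<tau> a) (\<tau> (Suc a)) * opW S w P (\<tau> (Suc a)) (\<tau> a)) *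
      (P (\<tau> a) (k (Suc a) + int a) * P (\<tau> (Suc a)) (k (Suc a) + int a))" for \<tau>
  proof -
    have "slot S w k n B \<tau> (Suc a) = (\<Sum>x\<in>S. P (Suc n) (1 - k (Suc a)) * P (\<tau> a) (k (Suc a) + 1) * P (\<tau> (Suc a)) (k (Suc a)) *
        (w (fst x) (snd x) * (P (\<tau> (Suc a)) (snd x) * P (\<tau> a) (- fst x))))"
      unfolding slot_def
    proof (rule sum.cong[OF refl])
      fix x assume "x \<in> S"
      \<comment> \<open>Since both neighbouring intervals end at this position, its decoration drops
        out of the exponent of X_(n+1).\<close>
      have "P (Suc n) (1 - k (Suc a)) = P (Suc n) (k (Suc a) + (snd x - fst x)) * P (Suc n) (1 - (k (Suc a) + snd x)) * P (Suc n) (- (k (Suc a) - fst x))"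
        by (simp flip: P_add)
      moreover have "P (\<tau> a) (k (Suc a) - fst x + 1) = P (\<tau> a) (k (Suc a) + 1) * P (\<tau> a) (- fst x)"
        by (simp flip: P_add add: algebra_simps)
      ultimately show "w (fst x) (snd x) * P (Suc n) (k (Suc a) + (snd x - fst x)) *
         (if Suc a \<in> {1..n} - B then P (\<tau> (Suc a)) (k (Suc a) + snd x) * P (Suc n) (1 - (k (Suc a) + snd x)) else 1) *
         (if Suc a \<in> Suc ` B then P (\<tau> (Suc a - 1)) (k (Suc a) - fst x + 1) * P (Suc n) (- (k (Suc a) - fst x)) else 1) =
         P (Suc n) (1 - k (Suc a)) * P (\<tau> a) (k (Suc a) + 1) * P (\<tau> (Suc a)) (k (Suc a)) *
        (w (fst x) (snd x) * (P (\<tau> (Suc a)) (snd x) * P (\<tau> a) (- fst x)))"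
        using a by (simp add: P_add[of _ "k (Suc a)" "snd x"] mult_ac)
    qed
    also have "\<dots> = P (Suc n) (1 - k (Suc a)) * P (\<tau> a) (k (Suc a) + 1) * P (\<tau> (Suc a)) (k (Suc a)) * opW S w P (\<tau> (Suc a)) (\<tau> a)"
      by (simp add: opW_def sum_distrib_left case_prod_beta)
    finally have 1: "slot S w k n B \<tau> (Suc a) = \<dots>" .
    \<comment> \<open>The staircase exponents \<open>a - 1\<close> and \<open>a\<close> differ by
      one, and the extra 1 in the right end point levels them. Both variables get the same exponent,
      so only the two W factors distinguish them.\<close>
    have "P (\<tau> a) (k (Suc a) + int a) = P (\<tau> a) (int a - 1) * P (\<tau> a) (k (Suc a) + 1)"
      "P (\<tau> (Suc a)) (k (Suc a) + int a) = P (\<tau> (Suc a)) (int a) * P (\<tau> (Suc a)) (k (Suc a))"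
      by (simp_all flip: P_add add: algebra_simps)
    then show ?thesis unfolding mid_def 1 by (simp only: mult_ac)
  qed
  define rest where "rest = (\<lambda>\<tau>. (\<Prod>(p,q)\<in>pairs_le n - {(a, Suc a)}. opW S w P (\<tau> p) (\<tau> q)) *
      (\<Prod>i\<in>{1..n} - {a, Suc a}. P (\<tau> i) (int i - 1)) * (\<Prod>j\<in>{1..Suc n} - {Suc a}. slot S w k n B \<tau> j))"
  have split: "slots S w k n B \<tau> = rest \<tau> * mid \<tau>" for \<tau>
  proof -
    have "(\<Prod>(p,q)\<in>pairs_le n. opW S w P (\<tau> p) (\<tau> q)) = opW S w P (\<tau> a) (\<tau> (Suc a)) * (\<Prod>(p,q)\<in>pairs_le n - {(a, Suc a)}. opW S w P (\<tau> p) (\<tau> q))"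
    proof -
      have "(a, Suc a) \<in> pairs_le n" using a a1 by (simp add: pairs_le_def)
      from prod.remove[OF finite_pairs_le this, of "\<lambda>(p,q). opW S w P (\<tau> p) (\<tau> q)"] show ?thesis by simp
    qed
    moreover have "(\<Prod>j=1..Suc n. slot S w k n B \<tau> j) = slot S w k n B \<tau> (Suc a) * (\<Prod>j\<in>{1..Suc n} - {Suc a}. slot S w k n B \<tau> j)"
      using a a1 by (intro prod.remove) auto
    moreover have "(\<Prod>i=1..n. P (\<tau> i) (int i - 1)) = P (\<tau> a) (int a - 1) * P (\<tau> (Suc a)) (int a) * (\<Prod>i\<in>{1..n} - {a, Suc a}. P (\<tau> i) (int i - 1))"
    proof -
      have "{1..n} - {a} - {Suc a} = {1..n} - {a, Suc a}" by auto
      then show ?thesis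
        using a a1 by (subst prod.remove[of _ a], simp, simp, subst prod.remove[of _ "Suc a"]) (simp_all add: mult_ac)
    qed
    ultimately show ?thesis unfolding slots_def rest_def mid_def by (simp only: mult_ac)
  qed
  have "mid (\<tau> \<circ> ?t) = mid \<tau>" unfolding mid by (simp add: mult_ac)
  moreover have "rest (\<tau> \<circ> ?t) = rest \<tau>"
  proof -
    \<comment> \<open>An adjacent transposition reverses the order of no other pair, so it permutes
      the remaining index pairs.\<close>
    have 1: "(\<Prod>(p,q)\<in>pairs_le n - {(a, Suc a)}. opW S w P ((\<tau> \<circ> ?t) p) ((\<tau> \<circ> ?t) q)) = (\<Prod>(p,q)\<in>pairs_le n - {(a, Suc a)}. opW S w P (\<tau> p) (\<tau> q))"
      using a a1
      by (intro prod.reindex_bij_witness[where i = "map_prod ?t ?t" and j = "map_prod ?t ?t"])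
         (auto simp: pairs_le_def transpose_def split: if_splits)
    have 2: "(\<Prod>i\<in>{1..n} - {a, Suc a}. P ((\<tau> \<circ> ?t) i) (int i - 1)) = (\<Prod>i\<in>{1..n} - {a, Suc a}. P (\<tau> i) (int i - 1))"
      by (rule prod.cong) auto
    \<comment> \<open>As \<open>a\<close> lies in \<open>B\<close> and \<open>Suc a\<close> does
      not, both variables enter only the slot at \<open>Suc a\<close>.\<close>
    have "slot S w k n B (\<tau> \<circ> ?t) j = slot S w k n B \<tau> j" if j: "j \<noteq> Suc a" for j
    proof -
      have "(\<tau> \<circ> ?t) j = \<tau> j" if "j \<in> {1..n} - B" using that j a by (auto simp: transpose_def)
      moreover have "(\<tau> \<circ> ?t) (j - 1) = \<tau> (j - 1)" if "j \<in> Suc ` B" using that j a by (auto simp: transpose_def)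
      ultimately show ?thesis unfolding slot_def by (intro sum.cong) auto
    qed
    then have 3: "(\<Prod>j\<in>{1..Suc n} - {Suc a}. slot S w k n B (\<tau> \<circ> ?t) j) = (\<Prod>j\<in>{1..Suc n} - {Suc a}. slot S w k n B \<tau> j)"
      by (intro prod.cong) auto
    show ?thesis unfolding rest_def 1 2 3 ..
  qed
  ultimately show "slots S w k n B (\<tau> \<circ> ?t) = slots S w k n B \<tau>" unfolding split by simp
qed

section \<open>Up-closed choices of end points: inserting the last variable\<close>

lemma P_int: "P i (int m) = P i 1 ^ m"
  by (induction m) (simp_all add: P_add)

text \<open>\<open>skip\<close> enumerates the positions other than \<open>m\<close> in increasing
  order, so the pairs avoiding \<open>m\<close> are an order-preserving copy of those for
  \<open>n\<close>.\<close>

lemma pairs_le_insert: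
  assumes m: "m \<in> {1..Suc n}"
  defines "skip \<equiv> \<lambda>i. if i < m then i else Suc i"
  shows "(\<Prod>(p,q)\<in>pairs_le (Suc n). f p q) = (\<Prod>(p,q)\<in>pairs_le n. f (skip p) (skip q)) *
     (f m m * (\<Prod>j=1..<m. f j m) * (\<Prod>j=Suc m..Suc n. f m j))"
proof -
  let ?A = "map_prod skip skip ` pairs_le n" and ?B = "(\<lambda>j. (j,m)) ` {1..<m}" and ?C = "(\<lambda>j. (m,j)) ` {Suc m..Suc n}"
  have inj: "inj_on (map_prod skip skip) (pairs_le n)" 
    by (auto simp: inj_on_def skip_def split: if_splits)
  have *: "(p,q) \<in> ?A" if "(p,q) \<in> pairs_le (Suc n)" "p \<noteq> m" "q \<noteq> m" for p q
  proof -
    have "(p,q) = map_prod skip skip (if p < m then p else p - 1, if q < m then q else q - 1)"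
      using that by (auto simp: skip_def)
    moreover have "(if p < m then p else p - 1, if q < m then q else q - 1) \<in> pairs_le n"
      using that m by (auto simp: pairs_le_def)
    ultimately show ?thesis by blast
  qed
  have "pairs_le (Suc n) = ?A \<union> insert (m,m) (?B \<union> ?C)"
  proof (intro set_eqI iffI)
    fix x assume "x \<in> pairs_le (Suc n)"
    then obtain p q where x: "x = (p,q)" "(p,q) \<in> pairs_le (Suc n)" by (cases x) auto
    then have "1 \<le> p" "p \<le> q" "q \<le> Suc n" by (auto simp: pairs_le_def)
    then consider "p \<noteq> m" "q \<noteq> m" | "p = m" "q = m" | "p = m" "q \<in> {Suc m..Suc n}" | "q = m" "p \<in> {1..<m}"
      by fastforce
    then show "x \<in> ?A \<union> insert (m,m) (?B \<union> ?C)" using *[of p q] x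
      by cases auto
  qed (use m in \<open>auto simp: pairs_le_def skip_def split: if_splits\<close>)
  also have "prod (case_prod f) \<dots> = prod (case_prod f) ?A * (prod (case_prod f) (insert (m,m) (?B \<union> ?C)))"
    by (rule prod.union_disjoint) (auto simp: skip_def split: if_splits)
  also have "prod (case_prod f) (insert (m,m) (?B \<union> ?C)) = f m m * prod (case_prod f) (?B \<union> ?C)"
    by (subst prod.insert) auto
  also have "prod (case_prod f) (?B \<union> ?C) = prod (case_prod f) ?B * prod (case_prod f) ?C"
    by (rule prod.union_disjoint) auto
  also have "prod (case_prod f) ?B = (\<Prod>j=1..<m. f j m)"
    by (subst prod.reindex) (auto simp: inj_on_def)
  also have "prod (case_prod f) ?C = (\<Prod>j=Suc m..Suc n. f m j)"
    by (subst prod.reindex) (auto simp: inj_on_def)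
  also have "prod (case_prod f) ?A = (\<Prod>(p,q)\<in>pairs_le n. f (skip p) (skip q))"
    by (subst prod.reindex[OF inj]) (auto intro!: prod.cong)
  finally show ?thesis by (simp only: mult_ac)
qed

text \<open>For \<open>B = {m..n}\<close>, positions before \<open>m\<close> take left ends and keep
  their variable, positions after \<open>m\<close> take right ends and receive the variable of their
  left neighbour. Position \<open>m\<close> takes no end and holds X_(n+1) alone, which gives the
  diagonal factor.\<close>

lemma slots_up:
  assumes m: "m \<in> {1..Suc n}" and t: "\<tau> permutes {1..n}"
  defines "\<sigma> \<equiv> \<tau> \<circ> ins n m"
  shows "slots S w k n {m..n} \<tau> = (\<Prod>i=1..Suc n. P (\<sigma> i) (k i + int i - 1)) *
          (\<Prod>(p,q)\<in>pairs_le (Suc n). opW S w P (\<sigma> p) (\<sigma> q))"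
proof -
  let ?N = "Suc n" let ?W = "opW S w P"
  have s1: "\<sigma> j = \<tau> j" if "j < m" for j using that by (simp add: \<sigma>_def ins_def)
  have "\<tau> ?N = ?N" using t by (simp add: permutes_def)
  then have s2: "\<sigma> m = ?N" using m by (simp add: \<sigma>_def ins_def)
  have s3: "\<sigma> j = \<tau> (j - 1)" if "j \<in> {Suc m..?N}" for j using that by (simp add: \<sigma>_def ins_def)
  have P3: "P i (a + b + c) = P i a * (P i b * P i c)" for i a b c by (simp add: P_add mult_ac)
  have v1: "slot S w k n {m..n} \<tau> j = P ?N 1 * P (\<tau> j) (k j) * ?W (\<tau> j) ?N" if "j \<in> {1..<m}" for j
  proof -
    have "P ?N (k j + (snd x - fst x)) * P ?N (1 - (k j + snd x)) = P ?N 1 * P ?N (- fst x)" for x :: "int \<times> int"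
      by (simp flip: P_add)
    then show ?thesis using that m
      unfolding slot_def opW_def sum_distrib_left case_prod_beta
      by (intro sum.cong) (auto simp: P_add[of "\<tau> j" "k j"] mult_ac)
  qed
  have v2: "slot S w k n {m..n} \<tau> m = P ?N (k m) * ?W ?N ?N"
  proof -
    have "P ?N (k m + (snd x - fst x)) = P ?N (k m) * (P ?N (snd x) * P ?N (- fst x))" for x :: "int \<times> int"
      by (simp flip: P_add)
    then show ?thesis using m
      unfolding slot_def opW_def sum_distrib_left case_prod_beta
      by (intro sum.cong) (auto simp: mult_ac)
  qed
  have v3: "slot S w k n {m..n} \<tau> j = P (\<tau> (j - 1)) (k j + 1) * ?W ?N (\<tau> (j - 1))" if "j \<in> {Suc m..?N}" for j
  proof -
    have j: "j \<in> Suc ` {m..n}" "j \<notin> {1..n} - {m..n}" using that by auto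
    show ?thesis
      unfolding slot_def opW_def sum_distrib_left case_prod_beta
    proof (rule sum.cong[OF refl], goal_cases)
      case (1 x)
      have "P ?N (snd x) = P ?N (k j + (snd x - fst x)) * P ?N (- (k j - fst x))"
        by (simp flip: P_add)
      moreover have "P (\<tau> (j - 1)) (k j - fst x + 1) = P (\<tau> (j - 1)) (k j + 1) * P (\<tau> (j - 1)) (- fst x)"
        by (simp flip: P_add add: algebra_simps)
      ultimately show ?case using j by (simp only: if_True if_False mult_ac mult_1_left mult_1_right)
    qed
  qed
  have dec: "(\<Prod>j=1..?N. f j) = (\<Prod>j=1..<m. f j) * (f m * (\<Prod>j=Suc m..?N. f j))" for f :: "nat \<Rightarrow> 'b"
  proof -
    have "{1..?N} = {1..<m} \<union> insert m {Suc m..?N}" using m by auto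
    then have "(\<Prod>j=1..?N. f j) = (\<Prod>j=1..<m. f j) * prod f (insert m {Suc m..?N})"
      by (simp only:) (rule prod.union_disjoint, auto)
    then show ?thesis by simp
  qed
  have dec': "(\<Prod>i=1..n. P (\<tau> i) (int i - 1)) = (\<Prod>j=1..<m. P (\<tau> j) (int j - 1)) * (\<Prod>j=Suc m..?N. P (\<tau> (j - 1)) (int j - 2))"
  proof -
    have "{1..n} = {1..<m} \<union> {m..n}" using m by auto
    then have "(\<Prod>i=1..n. P (\<tau> i) (int i - 1)) = (\<Prod>j=1..<m. P (\<tau> j) (int j - 1)) * (\<Prod>j=m..n. P (\<tau> j) (int j - 1))"
      by (simp only:) (rule prod.union_disjoint, auto)
    \<comment> \<open>A variable moved from position \<open>j - 1\<close> to \<open>j\<close> has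
      the old staircase exponent \<open>j - 2\<close>; the missing 1 comes from the right end
      point.\<close>
    also have "(\<Prod>j=m..n. P (\<tau> j) (int j - 1)) = (\<Prod>j=Suc m..?N. P (\<tau> (j - 1)) (int j - 2))"
      by (subst prod.atLeast_Suc_atMost_Suc_shift) (auto intro!: prod.cong arg_cong2[where f = P])
    finally show ?thesis .
  qed
  have W: "(\<Prod>(p,q)\<in>pairs_le ?N. ?W (\<sigma> p) (\<sigma> q)) = (\<Prod>(p,q)\<in>pairs_le n. ?W (\<tau> p) (\<tau> q)) *
     (?W ?N ?N * (\<Prod>j=1..<m. ?W (\<tau> j) ?N) * (\<Prod>j=Suc m..?N. ?W ?N (\<tau> (j - 1))))"
  proof -
    have "\<sigma> (if i < m then i else Suc i) = \<tau> i" if "i \<in> {1..n}" for i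
      using that s1 s3[of "Suc i"] by auto
    then have "(\<Prod>(p,q)\<in>pairs_le n. ?W (\<sigma> (if p < m then p else Suc p)) (\<sigma> (if q < m then q else Suc q)))
       = (\<Prod>(p,q)\<in>pairs_le n. ?W (\<tau> p) (\<tau> q))"
      by (intro prod.cong) (auto simp: pairs_le_def)
    moreover have "(\<Prod>j=1..<m. ?W (\<sigma> j) (\<sigma> m)) = (\<Prod>j=1..<m. ?W (\<tau> j) ?N)"
      using s1 s2 by (intro prod.cong) auto
    moreover have "(\<Prod>j=Suc m..?N. ?W (\<sigma> m) (\<sigma> j)) = (\<Prod>j=Suc m..?N. ?W ?N (\<tau> (j - 1)))"
      using s3 s2 by (intro prod.cong) auto
    ultimately show ?thesis by (simp only: pairs_le_insert[OF m] s2)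
  qed
  have Pprod: "(\<Prod>i=1..?N. P (\<sigma> i) (k i + int i - 1)) =
     (\<Prod>j=1..<m. P (\<tau> j) (k j) * P (\<tau> j) (int j - 1)) * (P ?N (k m) * (\<Prod>j=1..<m. P ?N 1) *
      (\<Prod>j=Suc m..?N. P (\<tau> (j - 1)) (k j + 1) * P (\<tau> (j - 1)) (int j - 2)))"
  proof -
    have "(\<Prod>j=1..<m. P (\<sigma> j) (k j + int j - 1)) = (\<Prod>j=1..<m. P (\<tau> j) (k j) * P (\<tau> j) (int j - 1))"
      using s1 by (intro prod.cong) (auto simp flip: P_add simp: algebra_simps)
    moreover have "(\<Prod>j=Suc m..?N. P (\<sigma> j) (k j + int j - 1)) = (\<Prod>j=Suc m..?N. P (\<tau> (j - 1)) (k j + 1) * P (\<tau> (j - 1)) (int j - 2))"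
    proof (rule prod.cong[OF refl])
      fix j assume j: "j \<in> {Suc m..?N}"
      have "k j + int j - 1 = (k j + 1) + (int j - 2)" by simp
      then show "P (\<sigma> j) (k j + int j - 1) = P (\<tau> (j - 1)) (k j + 1) * P (\<tau> (j - 1)) (int j - 2)"
        using s3[OF j] by (simp only: P_add)
    qed
    \<comment> \<open>Each of the \<open>m - 1\<close> left ends leaves one factor X_(n+1), and
      together they form its staircase exponent.\<close>
    moreover have "P (\<sigma> m) (k m + int m - 1) = P ?N (k m) * (\<Prod>j=1..<m. P ?N 1)"
    proof -
      have "k m + int m - 1 = k m + int (m - 1)" using m by auto
      then show ?thesis using s2 by (simp only: P_add P_int) simp
    qed
    ultimately show ?thesis by (simp only: dec)
  qed
  have V: "(\<Prod>j=1..Suc n. slot S w k n {m..n} \<tau> j) =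
     (\<Prod>j=1..<m. P ?N 1 * P (\<tau> j) (k j) * ?W (\<tau> j) ?N) * (P ?N (k m) * ?W ?N ?N *
     (\<Prod>j=Suc m..?N. P (\<tau> (j - 1)) (k j + 1) * ?W ?N (\<tau> (j - 1))))"
    unfolding dec v2 by (intro arg_cong2[where f = "(*)"] prod.cong refl v1 v3)
  show ?thesis unfolding slots_def W Pprod V dec' prod.distrib by (simp only: mult_ac)
qed

text \<open>Sets \<open>B\<close> that are not up-closed cancel under alternation; the up-closed set
  \<open>{m..n}\<close> inserts the new variable at position \<open>m\<close>.\<close>

theorem vand_ggf:
  assumes S: "finite S"
  shows "vand P n * ggf S w P n k = alt_sum n (\<lambda>\<sigma>. (\<Prod>i=1..n. P (\<sigma> i) (k i + int i - 1)) *
          (\<Prod>(p,q)\<in>pairs_le n. opW S w P (\<sigma> p) (\<sigma> q)))"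
proof (induction n arbitrary: k)
  case 0
  have "pairs_le 0 = {}" by (auto simp: pairs_le_def)
  then show ?case by (simp add: vand_def alt_sum_def)
next
  case (Suc n)
  have "vand P (Suc n) * ggf S w P (Suc n) k = (\<Sum>B\<in>Pow {1..n}. (-1) ^ card B * alt_sum n (slots S w k n B))"
    by (rule vand_ggf_Suc[OF S Suc])
  also have "\<dots> = (\<Sum>B\<in>(\<lambda>m. {m..n}) ` {1..Suc n}. (-1) ^ card B * alt_sum n (slots S w k n B))"
  proof (rule sum.mono_neutral_right)
    show "\<forall>B\<in>Pow {1..n} - (\<lambda>m. {m..n}) ` {1..Suc n}. (-1) ^ card B * alt_sum n (slots S w k n B) = 0"
    proof
      fix B assume B: "B \<in> Pow {1..n} - (\<lambda>m. {m..n}) ` {1..Suc n}"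
      have "\<exists>a. a \<in> B \<and> Suc a \<notin> B \<and> Suc a \<le> n"
      proof (rule ccontr)
        assume "\<not> ?thesis"
        then have up: "\<And>a. a \<in> B \<Longrightarrow> a < n \<Longrightarrow> Suc a \<in> B" by (auto simp: Suc_le_eq)
        have "B \<noteq> {}"
        proof
          assume "B = {}"
          \<comment> \<open>The empty set counts as up-closed: it is the case
            \<open>m = Suc n\<close>, with the new variable appended at the end.\<close>
          then have "B = {Suc n..n}" by simp
          moreover have "Suc n \<in> {1..Suc n}" by simp
          ultimately show False using B by blast
        qed
        define m where "m = Min B"
        have fin: "finite B" using B by (auto intro: finite_subset)
        then have m: "m \<in> B" "\<And>x. x \<in> B \<Longrightarrow> m \<le> x" using \<open>B \<noteq> {}\<close> by (auto simp: m_def)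
        have "j \<in> B" if "m \<le> j" "j \<le> n" for j
          using that(1,2) by (induction j rule: dec_induct) (use m up in auto)
        then have "B = {m..n}" using m B by auto
        moreover have "m \<in> {1..Suc n}" using m B by auto
        ultimately show False using B by blast
      qed
      then show "(-1) ^ card B * alt_sum n (slots S w k n B) = 0"
        using B alt_sum_slots_eq_0 by auto
    qed
  qed auto
  also have "\<dots> = (\<Sum>m=1..Suc n. (-1) ^ (Suc n - m) * alt_sum n (slots S w k n {m..n}))"
  proof (subst sum.reindex)
    show "inj_on (\<lambda>m. {m..n}) {1..Suc n}"
      by (auto simp: inj_on_def Icc_eq_Icc)
  qed (simp add: o_def)
  also have "\<dots> = alt_sum (Suc n) (\<lambda>\<sigma>. (\<Prod>i=1..Suc n. P (\<sigma> i) (k i + int i - 1)) *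
          (\<Prod>(p,q)\<in>pairs_le (Suc n). opW S w P (\<sigma> p) (\<sigma> q)))"
    unfolding alt_sum_Suc
    by (intro sum.cong refl arg_cong2[where f = "(*)"] alt_sum_cong slots_up)
  finally show ?case .
qed

end

subsection \<open>Removing the bottom row of a triangle\<close>

lemma prod_ssgn: "finite A \<Longrightarrow> (\<Prod>j\<in>A. ssgn (f j) (g j)) = (-1) ^ card {j\<in>A. neg_sint (f j) (g j)}"
  unfolding ssgn_def by (simp add: prod.If_cases Int_def)

lemma tri_pos_Suc: "tri_pos (Suc n) = tri_pos n \<union> Pair (Suc n) ` {1..Suc n}"
  by (auto simp: tri_pos_def)

lemma finite_tri_pos [simp]: "finite (tri_pos n)"
  by (rule finite_subset[of _ "{1..n} \<times> {1..n}"]) (auto simp: tri_pos_def)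

lemma tri_sign_Suc:
  "tri_sign (Suc n) a d = tri_sign n a d *
     (\<Prod>j=1..n. ssgn (a (Suc n) j + snd (d (Suc n) j)) (a (Suc n) (Suc j) - fst (d (Suc n) (Suc j))))"
proof -
  let ?neg = "\<lambda>i j. neg_sint (a i j + snd (d i j)) (a i (Suc j) - fst (d i (Suc j)))"
  let ?A = "{(i,j). 2 \<le> i \<and> i \<le> n \<and> 1 \<le> j \<and> j < i \<and> ?neg i j}"
  let ?B = "{j\<in>{1..n}. ?neg (Suc n) j}"
  have fin: "finite ?A" by (rule finite_subset[of _ "{1..n} \<times> {1..n}"]) auto
  have "{(i,j). 2 \<le> i \<and> i \<le> Suc n \<and> 1 \<le> j \<and> j < i \<and> ?neg i j} = ?A \<union> Pair (Suc n) ` ?B"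
    by (auto simp: le_Suc_eq)
  moreover have "card (?A \<union> Pair (Suc n) ` ?B) = card ?A + card (Pair (Suc n) ` ?B)"
    by (rule card_Un_disjoint[OF fin]) auto
  moreover have "card (Pair (Suc n) ` ?B) = card ?B" by (rule card_image) (auto simp: inj_on_def)
  ultimately show ?thesis unfolding tri_sign_def
    by (subst prod_ssgn) (simp_all add: power_add)
qed

lemma tri_weight_Suc:
  "tri_weight w (Suc n) X a d = tri_weight w n X a d *
     ((\<Prod>j=1..Suc n. w (fst (d (Suc n) j)) (snd (d (Suc n) j))) *
      X (Suc n) powi ((\<Sum>j=1..Suc n. a (Suc n) j) - (\<Sum>j=1..n. a n j)
         + (\<Sum>j=1..Suc n. snd (d (Suc n) j) - fst (d (Suc n) j))))"
proof -
  have "(\<Prod>(i,j)\<in>tri_pos (Suc n). w (fst (d i j)) (snd (d i j))) =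
     (\<Prod>(i,j)\<in>tri_pos n. w (fst (d i j)) (snd (d i j))) *
     (\<Prod>(i,j)\<in>Pair (Suc n) ` {1..Suc n}. w (fst (d i j)) (snd (d i j)))"
    unfolding tri_pos_Suc
    by (rule prod.union_disjoint[OF finite_tri_pos]) (auto simp: tri_pos_def)
  also have "(\<Prod>(i,j)\<in>Pair (Suc n) ` {1..Suc n}. w (fst (d i j)) (snd (d i j))) =
     (\<Prod>j=1..Suc n. w (fst (d (Suc n) j)) (snd (d (Suc n) j)))"
    by (subst prod.reindex) (auto simp: inj_on_def simp del: prod.cl_ivl_Suc)
  finally have 1: "(\<Prod>(i,j)\<in>tri_pos (Suc n). w (fst (d i j)) (snd (d i j))) =
     (\<Prod>(i,j)\<in>tri_pos n. w (fst (d i j)) (snd (d i j))) *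
     (\<Prod>j=1..Suc n. w (fst (d (Suc n) j)) (snd (d (Suc n) j)))" .
  have 2: "(\<Prod>i=1..Suc n. f i) = (\<Prod>i=1..n. f i) * f (Suc n)" for f :: "nat \<Rightarrow> 'a"
    by simp
  show ?thesis
    unfolding tri_weight_def 1 2 diff_Suc_1 by (simp only: mult_ac)
qed

lemma tri_sign_cong:
  assumes "\<And>i j. i \<le> n \<Longrightarrow> a i j = a' i j" "\<And>i j. i \<le> n \<Longrightarrow> d i j = d' i j"
  shows "tri_sign n a d = tri_sign n a' d'"
  using assms unfolding tri_sign_def
  by (intro arg_cong2[where f = "(^)"] arg_cong[where f = card] refl Collect_cong) (auto simp: assms)

lemma tri_weight_cong:
  assumes "\<And>i j. i \<le> n \<Longrightarrow> a i j = a' i j" "\<And>i j. i \<le> n \<Longrightarrow> d i j = d' i j"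
  shows "tri_weight w n X a d = tri_weight w n X a' d'"
proof -
  have "(\<Prod>(i,j)\<in>tri_pos n. w (fst (d i j)) (snd (d i j))) = (\<Prod>(i,j)\<in>tri_pos n. w (fst (d' i j)) (snd (d' i j)))"
    by (rule prod.cong) (auto simp: tri_pos_def assms)
  moreover have "(\<Prod>i=1..n. X i powi ((\<Sum>j=1..i. a i j) - (\<Sum>j=1..i-1. a (i-1) j) + (\<Sum>j=1..i. snd (d i j) - fst (d i j))))
    = (\<Prod>i=1..n. X i powi ((\<Sum>j=1..i. a' i j) - (\<Sum>j=1..i-1. a' (i-1) j) + (\<Sum>j=1..i. snd (d' i j) - fst (d' i j))))"
    by (rule prod.cong) (auto simp: assms)
  ultimately show ?thesis unfolding tri_weight_def by simp
qed

section \<open>Splitting a triangle into its bottom row and the rest\<close>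

type_synonym triangle = "(nat \<Rightarrow> nat \<Rightarrow> int) \<times> (nat \<Rightarrow> nat \<Rightarrow> int \<times> int)"

definition add_row :: "nat \<Rightarrow> (nat \<Rightarrow> int) \<Rightarrow> (nat \<Rightarrow> int \<times> int) \<times> (nat \<Rightarrow> int) \<times> triangle \<Rightarrow> triangle" where
  "add_row n k = (\<lambda>(e, l, a, d).
     ((\<lambda>i j. if i = Suc n \<and> j \<in> {1..Suc n} then k j else a i j),
      (\<lambda>i j. if i = Suc n \<and> j \<in> {1..Suc n} then e j else d i j)))"

definition cut_row :: "nat \<Rightarrow> triangle \<Rightarrow> (nat \<Rightarrow> int \<times> int) \<times> (nat \<Rightarrow> int) \<times> triangle" where
  "cut_row n = (\<lambda>(a, d). (restrict (d (Suc n)) {1..Suc n}, restrict (a n) {1..n},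
     (\<lambda>i j. if i = Suc n then 0 else a i j), (\<lambda>i j. if i = Suc n then (0,0) else d i j)))"

definition rows :: "nat \<Rightarrow> (nat \<Rightarrow> int) \<Rightarrow> (nat \<Rightarrow> int \<times> int) \<Rightarrow> (nat \<Rightarrow> int) set" where
  "rows n k e = PiE {1..n} (\<lambda>j. sint (k j + snd (e j)) (k (Suc j) - fst (e (Suc j))))"

text \<open>The component \<open>l\<close> repeats the bottom row of the smaller triangle, so that
  the index set is a nested \<open>Sigma\<close> in the order of the sums in \<open>ggf\<close>.
  Rows are extensional functions, to match \<open>PiE\<close>, whereas triangles are 0 outside their
  positions; \<open>cut_row\<close> translates between the two.\<close>

definition row_data :: "nat \<Rightarrow> (nat \<Rightarrow> int) \<Rightarrow> (int \<times> int) set \<Rightarrow> ((nat \<Rightarrow> int \<times> int) \<times> (nat \<Rightarrow> int) \<times> triangle) set" where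
  "row_data n k S = (SIGMA e:PiE {1..Suc n} (\<lambda>_. S). SIGMA l:rows n k e. gteamt n l S)"

lemma bij_betw_add_row: "bij_betw (add_row n k) (row_data n k S) (gteamt (Suc n) k S)"
proof (rule bij_betw_byWitness[where f' = "cut_row n"])
  show "\<forall>x\<in>row_data n k S. cut_row n (add_row n k x) = x"
  proof
    fix x assume "x \<in> row_data n k S"
    then obtain e l a d where x: "x = (e, l, a, d)" "e \<in> PiE {1..Suc n} (\<lambda>_. S)" "l \<in> rows n k e" "(a,d) \<in> gteamt n l S"
      by (auto simp: row_data_def)
    \<comment> \<open>The normalisation to 0 outside the smaller triangle makes cutting the row an
      exact inverse.\<close>
    have z: "a (Suc n) j = 0" "d (Suc n) j = (0,0)" for j
      using x(4) by (auto simp: gteamt_def tri_pos_def)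
    have "restrict (a n) {1..n} = l"
      using x(3,4) by (auto simp: gteamt_def rows_def PiE_def extensional_def fun_eq_iff restrict_def)
    moreover have "restrict e {1..Suc n} = e" using x(2) by (auto simp: PiE_def extensional_restrict)
    moreover have "restrict (\<lambda>j. if Suc n = Suc n \<and> j \<in> {1..Suc n} then e j else d (Suc n) j) {1..Suc n} = restrict e {1..Suc n}"
      by (rule restrict_ext) simp
    moreover have "restrict (\<lambda>j. if n = Suc n \<and> j \<in> {1..Suc n} then k j else a n j) {1..n} = restrict (a n) {1..n}"
      by (rule restrict_ext) simp
    moreover have "(\<lambda>i j. if i = Suc n then 0 else if i = Suc n \<and> j \<in> {1..Suc n} then k j else a i j) = a"
      "(\<lambda>i j. if i = Suc n then (0,0) else if i = Suc n \<and> j \<in> {1..Suc n} then e j else d i j) = d"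
      using z by (auto simp: fun_eq_iff)
    ultimately show "cut_row n (add_row n k x) = x"
      unfolding x(1) add_row_def cut_row_def prod.case by (simp only:)
  qed
  show "\<forall>x\<in>gteamt (Suc n) k S. add_row n k (cut_row n x) = x"
    by (auto simp: gteamt_def add_row_def cut_row_def fun_eq_iff tri_pos_def)
  show "add_row n k ` row_data n k S \<subseteq> gteamt (Suc n) k S"
  proof clarify
    fix a' d' e l a d
    assume eq: "(a', d') = add_row n k (e, l, a, d)" and "(e, l, a, d) \<in> row_data n k S"
    then have x: "e \<in> PiE {1..Suc n} (\<lambda>_. S)" "l \<in> rows n k e" "(a,d) \<in> gteamt n l S"
      by (auto simp: row_data_def)
    have a': "a' i j = (if i = Suc n \<and> j \<in> {1..Suc n} then k j else a i j)"
      and d': "d' i j = (if i = Suc n \<and> j \<in> {1..Suc n} then e j else d i j)" for i j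
      using eq by (auto simp: add_row_def)
    have "in_sint (a' i j) (a' (Suc i) j + snd (d' (Suc i) j)) (a' (Suc i) (Suc j) - fst (d' (Suc i) (Suc j)))"
      if ij: "1 \<le> j" "j \<le> i" "i < Suc n" for i j
    proof (cases "i = n")
      case True
      then have "a i j = l j" using x(3) ij by (auto simp: gteamt_def)
      moreover have "l j \<in> sint (k j + snd (e j)) (k (Suc j) - fst (e (Suc j)))"
        using x(2) ij True by (auto simp: rows_def)
      ultimately show ?thesis using ij True by (simp add: a' d' sint_def)
    next
      case False
      then show ?thesis using x(3) ij by (auto simp: gteamt_def a' d')
    qed
    moreover have "d' i j \<in> S" if "(i,j) \<in> tri_pos (Suc n)" for i j
    proof (cases "i = Suc n")
      case True
      then show ?thesis using that x(1) by (auto simp: d' tri_pos_def)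
    next
      case False
      then have "(i,j) \<in> tri_pos n" using that by (auto simp: tri_pos_def)
      then show ?thesis using False x(3) by (auto simp: d' gteamt_def)
    qed
    moreover have "a' i j = 0 \<and> d' i j = (0,0)" if "(i,j) \<notin> tri_pos (Suc n)" for i j
    proof -
      have "(i,j) \<notin> tri_pos n" using that by (auto simp: tri_pos_def)
      then have "a i j = 0 \<and> d i j = (0,0)" using x(3) by (auto simp: gteamt_def)
      then show ?thesis using that by (auto simp: a' d' tri_pos_def)
    qed
    moreover have "a' (Suc n) j = k j" if "j \<in> {1..Suc n}" for j using that by (simp add: a')
    ultimately show "(a', d') \<in> gteamt (Suc n) k S" by (auto simp: gteamt_def)
  qed
  show "cut_row n ` gteamt (Suc n) k S \<subseteq> row_data n k S"
  proof clarify
    fix e l a' d' a d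
    assume eq: "(e, l, a', d') = cut_row n (a, d)" and g: "(a, d) \<in> gteamt (Suc n) k S"
    have z: "\<And>i j. (i,j) \<notin> tri_pos (Suc n) \<Longrightarrow> a i j = 0 \<and> d i j = (0,0)"
      and dS: "\<And>i j. (i,j) \<in> tri_pos (Suc n) \<Longrightarrow> d i j \<in> S"
      and ak: "\<And>j. j \<in> {1..Suc n} \<Longrightarrow> a (Suc n) j = k j"
      and int: "\<And>i j. 1 \<le> j \<Longrightarrow> j \<le> i \<Longrightarrow> i < Suc n \<Longrightarrow>
        in_sint (a i j) (a (Suc i) j + snd (d (Suc i) j)) (a (Suc i) (Suc j) - fst (d (Suc i) (Suc j)))"
      using g unfolding gteamt_def by blast+
    have e: "e = restrict (d (Suc n)) {1..Suc n}" and l: "l = restrict (a n) {1..n}"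
      and a': "a' = (\<lambda>i j. if i = Suc n then 0 else a i j)"
      and d': "d' = (\<lambda>i j. if i = Suc n then (0,0) else d i j)"
      using eq by (auto simp: cut_row_def)
    have "e \<in> PiE {1..Suc n} (\<lambda>_. S)" using dS by (auto simp: e tri_pos_def)
    moreover have "l \<in> rows n k e"
      using int[of _ n] ak by (auto simp: l e rows_def sint_def)
    moreover have "(a', d') \<in> gteamt n l S"
    proof -
      have "a' i j = 0 \<and> d' i j = (0,0)" if "(i,j) \<notin> tri_pos n" for i j
        using that z[of i j] by (auto simp: a' d' tri_pos_def le_Suc_eq)
      moreover have "d' i j \<in> S" if "(i,j) \<in> tri_pos n" for i j
        using that dS[of i j] by (auto simp: d' tri_pos_def)
      moreover have "a' n j = l j" if "j \<in> {1..n}" for j using that by (auto simp: a' l)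
      moreover have "in_sint (a' i j) (a' (Suc i) j + snd (d' (Suc i) j)) (a' (Suc i) (Suc j) - fst (d' (Suc i) (Suc j)))"
        if "1 \<le> j" "j \<le> i" "i < n" for i j
        using int[of j i] that by (simp add: a' d')
      ultimately show ?thesis by (auto simp: gteamt_def)
    qed
    ultimately show "(e, l, a', d') \<in> row_data n k S" by (auto simp: row_data_def)
  qed
qed

lemma finite_rows [simp]: "finite (rows n k e)"
  by (auto simp: rows_def intro: finite_PiE)

lemma gteamt_0: "gteamt 0 k S = {(\<lambda>_ _. 0, \<lambda>_ _. (0,0))}"
  by (auto simp: gteamt_def tri_pos_def fun_eq_iff)

lemma finite_gteamt: "finite S \<Longrightarrow> finite (gteamt n k S)"
proof (induction n arbitrary: k)
  case 0
  then show ?case by (simp add: gteamt_0)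
next
  case (Suc n)
  then have "finite (row_data n k S)"
    unfolding row_data_def by (auto intro!: finite_SigmaI finite_PiE)
  then show ?case using bij_betw_finite[OF bij_betw_add_row] by blast
qed

lemma sum_row_data:
  assumes "finite S"
  shows "(\<Sum>(e,l,t)\<in>row_data n k S. F e l t) =
    (\<Sum>e\<in>PiE {1..Suc n} (\<lambda>_. S). \<Sum>l\<in>rows n k e. \<Sum>t\<in>gteamt n l S. F e l t)"
proof -
  have "(\<Sum>l\<in>rows n k e. \<Sum>t\<in>gteamt n l S. F e l t) = (\<Sum>(l,t)\<in>(SIGMA l:rows n k e. gteamt n l S). F e l t)" for e
    by (subst sum.Sigma) (auto simp: assms finite_gteamt)
  then show ?thesis unfolding row_data_def
    by (simp only:) (subst sum.Sigma, auto intro!: finite_PiE finite_SigmaI finite_gteamt simp: assms)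
qed

text \<open>Neither the sign nor the weight of the upper rows depends on the bottom row, so the sum
  over all extensions of a fixed row above is again a generating function.\<close>

lemma gen_fun_eq_ggf:
  assumes S: "finite (wsupp w)"
  shows "gen_fun w n k X = ggf (wsupp w) w (\<lambda>i e. X i powi e) n k"
proof (induction n arbitrary: k)
  case 0
  have "tri_pos 0 = {}" by (auto simp: tri_pos_def)
  moreover have "tri_sign 0 a d = 1" for a d
    unfolding tri_sign_def by (subst card_0_eq[THEN iffD2]) (auto intro: finite_subset[of _ "{}"])
  ultimately show ?case
    by (simp add: gen_fun_def gteamt_0 tri_weight_def)
next
  case (Suc n)
  let ?S = "wsupp w" let ?D = "PiE {1..Suc n} (\<lambda>_. ?S)"
  let ?f = "\<lambda>(a,d). of_int (tri_sign (Suc n) a d) * tri_weight w (Suc n) X a d"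
  let ?sg = "\<lambda>e. \<Prod>j=1..n. of_int (ssgn (k j + snd (e j)) (k (Suc j) - fst (e (Suc j)))) :: 'a"
  let ?wt = "\<lambda>e. \<Prod>j=1..Suc n. w (fst (e j)) (snd (e j))"
  let ?X = "\<lambda>e l. X (Suc n) powi ((\<Sum>j=1..Suc n. k j) - (\<Sum>j=1..n. l j)
          + (\<Sum>j=1..Suc n. snd (e j) - fst (e j)))"
  have summand: "?f (add_row n k (e, l, a, d)) = ?wt e * (?sg e * ?X e l * (of_int (tri_sign n a d) * tri_weight w n X a d))"
    if "(a, d) \<in> gteamt n l ?S" for e l a d
  proof -
    let ?a = "\<lambda>i j. if i = Suc n \<and> j \<in> {1..Suc n} then k j else a i j"
    let ?d = "\<lambda>i j. if i = Suc n \<and> j \<in> {1..Suc n} then e j else d i j"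
    have "tri_sign n ?a ?d = tri_sign n a d" by (rule tri_sign_cong) auto
    moreover have "tri_weight w n X ?a ?d = tri_weight w n X a d" by (rule tri_weight_cong) auto
    moreover have "(\<Prod>j=1..n. ssgn (?a (Suc n) j + snd (?d (Suc n) j)) (?a (Suc n) (Suc j) - fst (?d (Suc n) (Suc j))))
       = (\<Prod>j=1..n. ssgn (k j + snd (e j)) (k (Suc j) - fst (e (Suc j))))"
      by (rule prod.cong) auto
    moreover have "(\<Prod>j=1..Suc n. w (fst (?d (Suc n) j)) (snd (?d (Suc n) j))) = ?wt e"
      by (rule prod.cong) auto
    moreover have "(\<Sum>j=1..Suc n. ?a (Suc n) j) = (\<Sum>j=1..Suc n. k j)" by (rule sum.cong) auto
    moreover have "(\<Sum>j=1..n. ?a n j) = (\<Sum>j=1..n. l j)"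
      using that by (intro sum.cong) (auto simp: gteamt_def)
    moreover have "(\<Sum>j=1..Suc n. snd (?d (Suc n) j) - fst (?d (Suc n) j)) = (\<Sum>j=1..Suc n. snd (e j) - fst (e j))"
      by (rule sum.cong) auto
    ultimately show ?thesis
      unfolding add_row_def prod.case tri_sign_Suc tri_weight_Suc of_int_mult of_int_prod[symmetric]
      by (simp only: mult_ac)
  qed
  have "gen_fun w (Suc n) k X = sum ?f (gteamt (Suc n) k ?S)" by (simp only: gen_fun_def)
  also have "\<dots> = (\<Sum>x\<in>row_data n k ?S. ?f (add_row n k x))"
    by (rule sum.reindex_bij_betw[OF bij_betw_add_row, symmetric])
  also have "\<dots> = (\<Sum>(e, l, a, d)\<in>row_data n k ?S. ?wt e * (?sg e * ?X e l * (of_int (tri_sign n a d) * tri_weight w n X a d)))"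
  proof (rule sum.cong[OF refl], goal_cases)
    case (1 x)
    obtain e l a d where x: "x = (e, l, a, d)" by (cases x) auto
    with 1 have "(a, d) \<in> gteamt n l ?S" by (auto simp: row_data_def)
    from summand[OF this, of e] show ?case unfolding x by simp
  qed
  also have "\<dots> = (\<Sum>e\<in>?D. \<Sum>l\<in>rows n k e. \<Sum>(a, d)\<in>gteamt n l ?S. ?wt e * (?sg e * ?X e l * (of_int (tri_sign n a d) * tri_weight w n X a d)))"
    using sum_row_data[OF S, of "\<lambda>e l (a, d). ?wt e * (?sg e * ?X e l * (of_int (tri_sign n a d) * tri_weight w n X a d))" n k] .
  also have "\<dots> = (\<Sum>e\<in>?D. ?wt e * (\<Sum>l\<in>rows n k e. ?sg e * ?X e l * gen_fun w n l X))"
    by (simp only: sum_distrib_left gen_fun_def case_prod_beta' mult.assoc)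
  also have "\<dots> = ggf ?S w (\<lambda>i e. X i powi e) (Suc n) k"
    by (simp only: Suc ggf.simps rows_def)
  finally show ?case .
qed

subsection \<open>Branching of Schur polynomials\<close>

definition is_partition :: "nat \<Rightarrow> (nat \<Rightarrow> nat) \<Rightarrow> bool" where
  "is_partition n mu \<longleftrightarrow> (\<forall>r\<in>{1..<n}. mu (Suc r) \<le> mu r)"

lemma is_partitionD:
  assumes "is_partition n mu" "1 \<le> r" "r \<le> r'" "r' \<le> n"
  shows "mu r' \<le> mu r"
  using assms(3,4)
proof (induction r' rule: dec_induct)
  case (step r')
  then have "mu (Suc r') \<le> mu r'" using assms(1,2) by (auto simp: is_partition_def)
  with step show ?case by auto
qed simp

text \<open>For a partition \<open>mu\<close>, these are the shapes \<open>nu\<close> with at most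
  \<open>n\<close> rows such that \<open>mu / nu\<close> is a horizontal strip.\<close>

definition interlacing :: "nat \<Rightarrow> (nat \<Rightarrow> nat) \<Rightarrow> (nat \<Rightarrow> nat) set" where
  "interlacing n mu = PiE {1..n} (\<lambda>r. {mu (Suc r)..mu r})"

lemma interlacingD: "nu \<in> interlacing n mu \<Longrightarrow> r \<in> {1..n} \<Longrightarrow> mu (Suc r) \<le> nu r \<and> nu r \<le> mu r"
  by (auto simp: interlacing_def PiE_def Pi_def)

lemma interlacing_is_partition: "nu \<in> interlacing n mu \<Longrightarrow> is_partition n nu"
  unfolding is_partition_def
proof
  fix r assume "nu \<in> interlacing n mu" "r \<in> {1..<n}"
  then show "nu (Suc r) \<le> nu r"
    using interlacingD[of nu n mu r] interlacingD[of nu n mu "Suc r"] by auto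
qed

lemma finite_yd_cells [simp]: "finite (yd_cells n mu)"
proof -
  have "yd_cells n mu = (SIGMA r:{1..n}. {1..mu r})" by (auto simp: yd_cells_def)
  then show ?thesis by simp
qed

lemma card_yd_cells: "card (yd_cells n mu) = (\<Sum>r=1..n. mu r)"
proof -
  have "yd_cells n mu = (SIGMA r:{1..n}. {1..mu r})" by (auto simp: yd_cells_def)
  then show ?thesis by simp
qed

section \<open>Splitting a tableau into its small entries and the strip of maximal ones\<close>

definition row_len :: "nat \<Rightarrow> (nat \<Rightarrow> nat) \<Rightarrow> (nat \<Rightarrow> nat \<Rightarrow> nat) \<Rightarrow> nat \<Rightarrow> nat" where
  "row_len n mu T = restrict (\<lambda>r. card {c\<in>{1..mu r}. T r c \<le> n}) {1..n}"

definition cut_max :: "nat \<Rightarrow> (nat \<Rightarrow> nat) \<Rightarrow> (nat \<Rightarrow> nat \<Rightarrow> nat) \<Rightarrow> nat \<Rightarrow> nat \<Rightarrow> nat" where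
  "cut_max n nu T = (\<lambda>r c. if (r,c) \<in> yd_cells n nu then T r c else 0)"

definition fill_max :: "nat \<Rightarrow> (nat \<Rightarrow> nat) \<Rightarrow> (nat \<Rightarrow> nat) \<Rightarrow> (nat \<Rightarrow> nat \<Rightarrow> nat) \<Rightarrow> nat \<Rightarrow> nat \<Rightarrow> nat" where
  "fill_max n mu nu T = (\<lambda>r c. if (r,c) \<in> yd_cells n nu then T r c
     else if (r,c) \<in> yd_cells (Suc n) mu then Suc n else 0)"

lemma interlacing_yd_cells: "nu \<in> interlacing n mu \<Longrightarrow> yd_cells n nu \<subseteq> yd_cells (Suc n) mu"
  using interlacingD by (fastforce simp: yd_cells_def)

text \<open>Columns increase strictly from at least 1. In particular row \<open>Suc n\<close>
  contains only the maximal entry, so the small entries occupy at most \<open>n\<close>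
  rows.\<close>

lemma ssyt_ge_row:
  assumes "is_partition n mu" "T \<in> ssyt n mu" "(r,c) \<in> yd_cells n mu"
  shows "r \<le> T r c"
  using assms(3)
proof (induction r)
  case (Suc r)
  show ?case
  proof (cases "r = 0")
    case True
    then show ?thesis using Suc.prems assms(2) by (auto simp: ssyt_def)
  next
    case False
    then have "(r,c) \<in> yd_cells n mu"
      using Suc.prems is_partitionD[OF assms(1), of r "Suc r"] by (auto simp: yd_cells_def)
    moreover from this have "T r c < T (Suc r) c"
      using Suc.prems assms(2) by (auto simp: ssyt_def)
    ultimately show ?thesis using Suc.IH by simp
  qed
qed simp

lemma down_closed_eq:
  assumes "D \<subseteq> {1..m}" "\<And>c c'. c' \<in> D \<Longrightarrow> 1 \<le> c \<Longrightarrow> c < c' \<Longrightarrow> c \<in> D"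
  shows "D = {1..card D}"
proof (cases "D = {}")
  case False
  have fin: "finite D" using assms(1) finite_subset by blast
  have "c \<in> D" if "c \<in> {1..Max D}" for c
    using that assms(2)[OF Max_in[OF fin False], of c] Max_in[OF fin False]
    by (cases "c = Max D") auto
  moreover have "D \<subseteq> {1..Max D}" using assms(1) Max_ge[OF fin] by auto
  ultimately have "D = {1..Max D}" by blast
  then show ?thesis by (metis card_atLeastAtMost diff_Suc_1)
qed simp

text \<open>Weakly increasing rows make the entries up to \<open>n\<close> an initial segment of
  each row; strictly increasing columns force that segment to cover the row below.\<close>

lemma ssyt_row_len:
  assumes "is_partition (Suc n) mu" "T \<in> ssyt (Suc n) mu"
  shows "row_len n mu T \<in> interlacing n mu"
    and "\<And>r c. (r,c) \<in> yd_cells (Suc n) mu \<Longrightarrow> (T r c \<le> n \<longleftrightarrow> (r,c) \<in> yd_cells n (row_len n mu T))"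
proof -
  let ?D = "\<lambda>r. {c\<in>{1..mu r}. T r c \<le> n}"
  have D: "?D r = {1..card (?D r)}" if "r \<in> {1..n}" for r
  proof (rule down_closed_eq)
    fix c c' assume c: "c' \<in> ?D r" "1 \<le> c" "c < c'"
    then have "(r,c) \<in> yd_cells (Suc n) mu" "(r,c') \<in> yd_cells (Suc n) mu"
      using that by (auto simp: yd_cells_def)
    then have "T r c \<le> T r c'" using assms(2) c(3) by (auto simp: ssyt_def)
    then show "c \<in> ?D r" using c by auto
  qed auto
  show "row_len n mu T \<in> interlacing n mu"
    unfolding interlacing_def row_len_def
  proof (rule restrict_PiE_iff[THEN iffD2], rule ballI)
    fix r assume r: "r \<in> {1..n}"
    have "{1..mu (Suc r)} \<subseteq> ?D r"
    proof
      fix c assume c: "c \<in> {1..mu (Suc r)}"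
      have "mu (Suc r) \<le> mu r" using assms(1) r by (auto simp: is_partition_def)
      then have 1: "(r,c) \<in> yd_cells (Suc n) mu" "(Suc r,c) \<in> yd_cells (Suc n) mu"
        using r c by (auto simp: yd_cells_def)
      then have "T r c < T (Suc r) c" "T (Suc r) c \<le> Suc n" using assms(2) by (auto simp: ssyt_def)
      then show "c \<in> ?D r" using 1 by (auto simp: yd_cells_def)
    qed
    then have "card {1..mu (Suc r)} \<le> card (?D r)" by (rule card_mono[rotated]) simp
    moreover have "card (?D r) \<le> card {1..mu r}" by (rule card_mono) auto
    ultimately show "card (?D r) \<in> {mu (Suc r)..mu r}" by simp
  qed
  show "T r c \<le> n \<longleftrightarrow> (r,c) \<in> yd_cells n (row_len n mu T)" if rc: "(r,c) \<in> yd_cells (Suc n) mu" for r c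
  proof (cases "r = Suc n")
    case True
    then have "T r c \<ge> Suc n" using ssyt_ge_row[OF assms rc] by simp
    then show ?thesis using True by (auto simp: yd_cells_def)
  next
    case False
    then have r: "r \<in> {1..n}" using rc by (auto simp: yd_cells_def)
    have "T r c \<le> n \<longleftrightarrow> c \<in> ?D r" using rc by (auto simp: yd_cells_def)
    also have "\<dots> \<longleftrightarrow> c \<in> {1..card (?D r)}" using D[OF r] by simp
    also have "\<dots> \<longleftrightarrow> (r,c) \<in> yd_cells n (row_len n mu T)"
      using r unfolding yd_cells_def row_len_def by simp
    finally show ?thesis .
  qed
qed

lemma fill_max_ssyt:
  assumes mu: "is_partition (Suc n) mu" and nu: "nu \<in> interlacing n mu" and T: "T \<in> ssyt n nu"
  shows "fill_max n mu nu T \<in> ssyt (Suc n) mu"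
proof -
  let ?F = "fill_max n mu nu T"
  have sub: "yd_cells n nu \<subseteq> yd_cells (Suc n) mu" by (rule interlacing_yd_cells[OF nu])
  have in_T: "1 \<le> T r c \<and> T r c \<le> n" if "(r,c) \<in> yd_cells n nu" for r c
    using T that by (auto simp: ssyt_def)
  have row: "?F r c \<le> ?F r c'"
    if "(r,c) \<in> yd_cells (Suc n) mu" "(r,c') \<in> yd_cells (Suc n) mu" "c < c'" for r c c'
  proof (cases "(r,c') \<in> yd_cells n nu")
    case True
    then have "(r,c) \<in> yd_cells n nu" using that by (auto simp: yd_cells_def)
    moreover from this True have "T r c \<le> T r c'" using T that(3) by (auto simp: ssyt_def)
    ultimately show ?thesis using True by (simp add: fill_max_def)
  next
    case False
    then have "?F r c' = Suc n" using that by (simp add: fill_max_def)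
    then show ?thesis using in_T[of r c] by (auto simp: fill_max_def)
  qed
  have col: "?F r c < ?F r' c"
    if "(r,c) \<in> yd_cells (Suc n) mu" "(r',c) \<in> yd_cells (Suc n) mu" "r < r'" for r r' c
  proof -
    have r: "1 \<le> r" "r \<le> n" "r' \<le> Suc n" "c \<le> mu r'" "1 \<le> c" using that by (auto simp: yd_cells_def)
    \<comment> \<open>A cell with another cell of \<open>mu\<close> below it lies in
      \<open>nu\<close>, so no column receives the new maximal entry twice.\<close>
    have "mu r' \<le> mu (Suc r)" using r that(3) by (intro is_partitionD[OF mu]) auto
    also have "\<dots> \<le> nu r" using interlacingD[OF nu] r by auto
    finally have rc: "(r,c) \<in> yd_cells n nu" using r by (auto simp: yd_cells_def)
    show ?thesis
    proof (cases "(r',c) \<in> yd_cells n nu")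
      case True
      then have "T r c < T r' c" using rc T that(3) by (auto simp: ssyt_def)
      then show ?thesis using True rc by (simp add: fill_max_def)
    next
      case False
      then show ?thesis using rc in_T[OF rc] that by (simp add: fill_max_def)
    qed
  qed
  have "?F r c = 0" if "(r,c) \<notin> yd_cells (Suc n) mu" for r c
    using that sub by (auto simp: fill_max_def)
  moreover have "1 \<le> ?F r c \<and> ?F r c \<le> Suc n" if "(r,c) \<in> yd_cells (Suc n) mu" for r c
    using that in_T[of r c] by (auto simp: fill_max_def)
  ultimately show ?thesis using row col unfolding ssyt_def by blast
qed

lemma cut_max_ssyt:
  assumes "is_partition (Suc n) mu" "T \<in> ssyt (Suc n) mu"
  shows "cut_max n (row_len n mu T) T \<in> ssyt n (row_len n mu T)"
proof -
  let ?nu = "row_len n mu T"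
  have sub: "yd_cells n ?nu \<subseteq> yd_cells (Suc n) mu"
    by (rule interlacing_yd_cells[OF ssyt_row_len(1)[OF assms]])
  have "1 \<le> T r c \<and> T r c \<le> n" if "(r,c) \<in> yd_cells n ?nu" for r c
    using that sub ssyt_row_len(2)[OF assms, of r c] assms(2) by (auto simp: ssyt_def)
  moreover have "T r c \<le> T r c'"
    if "(r,c) \<in> yd_cells n ?nu" "(r,c') \<in> yd_cells n ?nu" "c < c'" for r c c'
    using that sub assms(2) unfolding ssyt_def by blast
  moreover have "T r c < T r' c"
    if "(r,c) \<in> yd_cells n ?nu" "(r',c) \<in> yd_cells n ?nu" "r < r'" for r r' c
    using that sub assms(2) unfolding ssyt_def by blast
  ultimately show ?thesis unfolding ssyt_def cut_max_def by auto
qed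

lemma bij_betw_fill_max:
  assumes mu: "is_partition (Suc n) mu"
  shows "bij_betw (\<lambda>(nu,T). fill_max n mu nu T) (SIGMA nu:interlacing n mu. ssyt n nu) (ssyt (Suc n) mu)"
proof (rule bij_betw_byWitness[where f' = "\<lambda>T. (row_len n mu T, cut_max n (row_len n mu T) T)"])
  show "\<forall>x\<in>SIGMA nu:interlacing n mu. ssyt n nu.
     (row_len n mu (case x of (nu, T) \<Rightarrow> fill_max n mu nu T),
      cut_max n (row_len n mu (case x of (nu, T) \<Rightarrow> fill_max n mu nu T)) (case x of (nu, T) \<Rightarrow> fill_max n mu nu T)) = x"
  proof
    fix x assume "x \<in> (SIGMA nu:interlacing n mu. ssyt n nu)"
    then obtain nu T where x: "x = (nu, T)" and nu: "nu \<in> interlacing n mu" and T: "T \<in> ssyt n nu" by blast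
    have "row_len n mu (fill_max n mu nu T) r = nu r" for r
    proof (cases "r \<in> {1..n}")
      case True
      have "{c\<in>{1..mu r}. fill_max n mu nu T r c \<le> n} = {1..nu r}"
        using True interlacingD[OF nu True] T by (fastforce simp: fill_max_def ssyt_def yd_cells_def)
      then show ?thesis using True by (simp add: row_len_def)
    next
      case False
      then show ?thesis using nu by (auto simp: row_len_def interlacing_def PiE_def extensional_def)
    qed
    then have 1: "row_len n mu (fill_max n mu nu T) = nu" by blast
    have "cut_max n nu (fill_max n mu nu T) = T"
      using T by (auto simp: cut_max_def fill_max_def ssyt_def fun_eq_iff)
    with 1 show "(row_len n mu (case x of (nu, T) \<Rightarrow> fill_max n mu nu T),
      cut_max n (row_len n mu (case x of (nu, T) \<Rightarrow> fill_max n mu nu T)) (case x of (nu, T) \<Rightarrow> fill_max n mu nu T)) = x"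
      by (simp add: x)
  qed
  show "\<forall>T\<in>ssyt (Suc n) mu. (case (row_len n mu T, cut_max n (row_len n mu T) T) of (nu, T) \<Rightarrow> fill_max n mu nu T) = T"
  proof
    fix T assume T: "T \<in> ssyt (Suc n) mu"
    have "fill_max n mu (row_len n mu T) (cut_max n (row_len n mu T) T) r c = T r c" for r c
    proof (cases "(r,c) \<in> yd_cells (Suc n) mu")
      case True
      then have "T r c \<le> Suc n" using T by (auto simp: ssyt_def)
      then show ?thesis
        using True ssyt_row_len(2)[OF mu T True] by (auto simp: fill_max_def cut_max_def)
    next
      case False
      then have "(r,c) \<notin> yd_cells n (row_len n mu T)" "T r c = 0"
        using interlacing_yd_cells[OF ssyt_row_len(1)[OF mu T]] T by (auto simp: ssyt_def)
      then show ?thesis using False by (simp add: fill_max_def)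
    qed
    then show "(case (row_len n mu T, cut_max n (row_len n mu T) T) of (nu, T) \<Rightarrow> fill_max n mu nu T) = T"
      by (simp add: fun_eq_iff)
  qed
  show "(\<lambda>(nu, T). fill_max n mu nu T) ` (SIGMA nu:interlacing n mu. ssyt n nu) \<subseteq> ssyt (Suc n) mu"
    using fill_max_ssyt[OF mu] by auto
  show "(\<lambda>T. (row_len n mu T, cut_max n (row_len n mu T) T)) ` ssyt (Suc n) mu \<subseteq> (SIGMA nu:interlacing n mu. ssyt n nu)"
    using ssyt_row_len(1)[OF mu] cut_max_ssyt[OF mu] by auto
qed

lemma finite_interlacing [simp]: "finite (interlacing n mu)"
  by (auto simp: interlacing_def intro: finite_PiE)

lemma ssyt_0: "ssyt 0 mu = {\<lambda>_ _. 0}"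
  by (auto simp: ssyt_def yd_cells_def fun_eq_iff)

lemma finite_ssyt: "is_partition n mu \<Longrightarrow> finite (ssyt n mu)"
proof (induction n arbitrary: mu)
  case 0
  then show ?case by (simp add: ssyt_0)
next
  case (Suc n)
  have "finite (SIGMA nu:interlacing n mu. ssyt n nu)"
    using Suc.IH interlacing_is_partition by auto
  then show ?case using bij_betw_finite[OF bij_betw_fill_max[OF Suc.prems]] by blast
qed

text \<open>The branching rule: the cells filled with the largest entry are those of
  \<open>mu\<close> outside \<open>nu\<close>, and their number is the exponent of the last
  variable.\<close>

lemma schur_Suc:
  assumes mu: "is_partition (Suc n) mu"
  shows "schur (Suc n) mu X =
    (\<Sum>nu\<in>interlacing n mu. X (Suc n) ^ ((\<Sum>r=1..Suc n. mu r) - (\<Sum>r=1..n. nu r)) * schur n nu X)"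
proof -
  have weight: "(\<Prod>(r,c)\<in>yd_cells (Suc n) mu. X (fill_max n mu nu T r c)) =
     X (Suc n) ^ ((\<Sum>r=1..Suc n. mu r) - (\<Sum>r=1..n. nu r)) * (\<Prod>(r,c)\<in>yd_cells n nu. X (T r c))"
    if nu: "nu \<in> interlacing n mu" for nu T
  proof -
    let ?C = "yd_cells (Suc n) mu" and ?c = "yd_cells n nu"
    have sub: "?c \<subseteq> ?C" by (rule interlacing_yd_cells[OF nu])
    have "(\<Prod>(r,c)\<in>?C. X (fill_max n mu nu T r c)) =
      (\<Prod>(r,c)\<in>?C - ?c. X (fill_max n mu nu T r c)) * (\<Prod>(r,c)\<in>?c. X (fill_max n mu nu T r c))"
      by (rule prod.subset_diff[OF sub]) simp
    also have "(\<Prod>(r,c)\<in>?C - ?c. X (fill_max n mu nu T r c)) = (\<Prod>_\<in>?C - ?c. X (Suc n))"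
      by (rule prod.cong) (auto simp: fill_max_def)
    also have "(\<Prod>(r,c)\<in>?c. X (fill_max n mu nu T r c)) = (\<Prod>(r,c)\<in>?c. X (T r c))"
      by (rule prod.cong) (auto simp: fill_max_def)
    also have "(\<Prod>_\<in>?C - ?c. X (Suc n)) = X (Suc n) ^ ((\<Sum>r=1..Suc n. mu r) - (\<Sum>r=1..n. nu r))"
      by (simp only: prod_constant card_Diff_subset[OF finite_yd_cells sub] card_yd_cells)
    finally show ?thesis .
  qed
  have "schur (Suc n) mu X = (\<Sum>x\<in>(SIGMA nu:interlacing n mu. ssyt n nu).
      \<Prod>(r,c)\<in>yd_cells (Suc n) mu. X ((case x of (nu, T) \<Rightarrow> fill_max n mu nu T) r c))"
    unfolding schur_def by (rule sum.reindex_bij_betw[OF bij_betw_fill_max[OF mu], symmetric])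
  also have "\<dots> = (\<Sum>(nu,T)\<in>(SIGMA nu:interlacing n mu. ssyt n nu).
      X (Suc n) ^ ((\<Sum>r=1..Suc n. mu r) - (\<Sum>r=1..n. nu r)) * (\<Prod>(r,c)\<in>yd_cells n nu. X (T r c)))"
    using weight by (intro sum.cong) auto
  also have "\<dots> = (\<Sum>nu\<in>interlacing n mu. \<Sum>T\<in>ssyt n nu.
      X (Suc n) ^ ((\<Sum>r=1..Suc n. mu r) - (\<Sum>r=1..n. nu r)) * (\<Prod>(r,c)\<in>yd_cells n nu. X (T r c)))"
    by (rule sum.Sigma[symmetric]) (auto intro: finite_ssyt interlacing_is_partition)
  finally show ?thesis by (simp only: schur_def sum_distrib_left)
qed

lemma schur_cong:
  assumes "\<And>r. r \<in> {1..n} \<Longrightarrow> mu r = nu r"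
  shows "schur n mu X = schur n nu X"
proof -
  have "yd_cells n mu = yd_cells n nu" using assms by (auto simp: yd_cells_def)
  then show ?thesis by (simp add: schur_def ssyt_def)
qed

section \<open>Trivial weights: Gelfand-Tsetlin patterns and Schur polynomials\<close>

text \<open>The signed generating function of Gelfand-Tsetlin patterns, with an arbitrary integer
  vector as bottom row.\<close>

abbreviation ggf1 :: "(nat \<Rightarrow> int \<Rightarrow> 'b::comm_ring_1) \<Rightarrow> nat \<Rightarrow> (nat \<Rightarrow> int) \<Rightarrow> 'b" where
  "ggf1 \<equiv> ggf {(0,0)} (\<lambda>_ _. 1)"

lemma ggf1_Suc:
  "ggf1 P (Suc n) k = (\<Sum>l\<in>PiE {1..n} (\<lambda>j. sint (k j) (k (Suc j))).
     (\<Prod>j=1..n. of_int (ssgn (k j) (k (Suc j)))) * P (Suc n) ((\<Sum>j=1..Suc n. k j) - (\<Sum>j=1..n. l j)) * ggf1 P n l)"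
proof -
  let ?d = "restrict (\<lambda>_. (0::int,0::int)) {1..Suc n}"
  have D: "PiE {1..Suc n} (\<lambda>_. {(0::int,0::int)}) = {?d}"
    by (simp add: PiE_singleton restrict_def)
  have "PiE {1..n} (\<lambda>j. sint (k j + snd (?d j)) (k (Suc j) - fst (?d (Suc j)))) = PiE {1..n} (\<lambda>j. sint (k j) (k (Suc j)))"
    by (rule PiE_cong) auto
  moreover have "(\<Prod>j=1..n. of_int (ssgn (k j + snd (?d j)) (k (Suc j) - fst (?d (Suc j))))) = (\<Prod>j=1..n. of_int (ssgn (k j) (k (Suc j))) :: 'a)"
    by (rule prod.cong) auto
  moreover have "(\<Sum>j=1..Suc n. snd (?d j) - fst (?d j)) = 0" by (rule sum.neutral) auto
  ultimately show ?thesis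
    unfolding ggf.simps D by (simp del: sum.cl_ivl_Suc prod.cl_ivl_Suc)
qed

text \<open>An increasing bottom row makes all intervals ordinary ones with sign 1, and the
  recursion becomes the branching rule. Indices are reversed because rows of patterns increase while
  partitions decrease.\<close>

lemma ggf1_eq_schur:
  fixes X :: "nat \<Rightarrow> 'a::field"
  assumes "\<And>j. j \<in> {1..n} \<Longrightarrow> 0 \<le> k j" "\<And>j. j \<in> {1..<n} \<Longrightarrow> k j \<le> k (Suc j)"
  shows "ggf1 (\<lambda>i e. X i powi e) n k = schur n (\<lambda>r. nat (k (n + 1 - r))) X"
  using assms
proof (induction n arbitrary: k)
  case 0
  have "yd_cells 0 mu = {}" for mu by (auto simp: yd_cells_def)
  then show ?case by (simp add: schur_def ssyt_0)
next
  case (Suc n)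
  let ?N = "Suc n"
  let ?mu = "\<lambda>r. nat (k (?N + 1 - r))"
  have inc: "k j \<le> k (Suc j)" if "j \<in> {1..n}" for j using Suc.prems(2)[of j] that by auto
  have mu: "is_partition ?N ?mu" unfolding is_partition_def
  proof
    fix r assume "r \<in> {1..<?N}"
    then have "k (?N + 1 - Suc r) \<le> k (Suc (?N + 1 - Suc r))" "Suc (?N + 1 - Suc r) = ?N + 1 - r"
      by (auto intro!: inc)
    then show "?mu (Suc r) \<le> ?mu r" by simp
  qed
  have sg: "(\<Prod>j=1..n. of_int (ssgn (k j) (k (Suc j)))) = (1::'a)"
  proof (rule prod.neutral, rule ballI)
    fix j assume "j \<in> {1..n}"
    then show "of_int (ssgn (k j) (k (Suc j))) = (1::'a)"
      using inc[of j] by (simp add: ssgn_def neg_sint_def)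
  qed
  have sint: "sint (k j) (k (Suc j)) = {k j..k (Suc j)}" if "j \<in> {1..n}" for j
    using inc[OF that] by (auto simp: sint_eq neg_sint_def)
  have rev: "(\<Sum>j=1..m. f j) = (\<Sum>r=1..m. f (m + 1 - r))" for f :: "nat \<Rightarrow> int" and m
    by (rule sum.reindex_bij_witness[where i = "\<lambda>r. m + 1 - r" and j = "\<lambda>r. m + 1 - r"]) auto
  have "ggf1 (\<lambda>i e. X i powi e) ?N k = (\<Sum>l\<in>PiE {1..n} (\<lambda>j. {k j..k (Suc j)}).
      X ?N powi ((\<Sum>j=1..?N. k j) - (\<Sum>j=1..n. l j)) * schur n (\<lambda>r. nat (l (n + 1 - r))) X)"
    unfolding ggf1_Suc sg
  proof (rule sum.cong, goal_cases)
    case 1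
    show ?case by (rule PiE_cong) (rule sint)
  next
    case (2 l)
    then have l: "k j \<le> l j \<and> l j \<le> k (Suc j)" if "j \<in> {1..n}" for j using that by (auto simp: PiE_def Pi_def)
    have "0 \<le> l j" if "j \<in> {1..n}" for j using l[OF that] Suc.prems(1)[of j] that by auto
    moreover have "l j \<le> l (Suc j)" if "j \<in> {1..<n}" for j using l[of j] l[of "Suc j"] that by auto
    ultimately have "ggf1 (\<lambda>i e. X i powi e) n l = schur n (\<lambda>r. nat (l (n + 1 - r))) X" by (rule Suc.IH)
    then show ?case by simp
  qed
  also have "\<dots> = (\<Sum>nu\<in>interlacing n ?mu. X ?N ^ ((\<Sum>r=1..?N. ?mu r) - (\<Sum>r=1..n. nu r)) * schur n nu X)"
  proof (rule sum.reindex_bij_witness[where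
        i = "\<lambda>nu. restrict (\<lambda>j. int (nu (n + 1 - j))) {1..n}" and
        j = "\<lambda>l. restrict (\<lambda>r. nat (l (n + 1 - r))) {1..n}"], goal_cases)
    case (1 l)
    then have "0 \<le> l j" if "j \<in> {1..n}" for j using Suc.prems(1)[of j] that by (force simp: PiE_def Pi_def)
    moreover have "l j = undefined" if "j \<notin> {1..n}" for j using 1 that by (auto simp: PiE_def extensional_def)
    ultimately show ?case by (auto simp: fun_eq_iff restrict_def)
  next
    case (2 l)
    show ?case unfolding interlacing_def
    proof (rule restrict_PiE_iff[THEN iffD2], rule ballI)
      fix r assume r: "r \<in> {1..n}"
      then have "n + 1 - r \<in> {1..n}" by auto
      with 2 have "l (n + 1 - r) \<in> {k (n + 1 - r)..k (Suc (n + 1 - r))}" by (auto simp: PiE_def Pi_def)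
      moreover have "Suc (n + 1 - r) = ?N + 1 - r" using r by auto
      ultimately show "nat (l (n + 1 - r)) \<in> {?mu (Suc r)..?mu r}" using r by (auto intro: nat_mono)
    qed
  next
    case (3 nu)
    then have "nu j = undefined" if "j \<notin> {1..n}" for j using that by (auto simp: interlacing_def PiE_def extensional_def)
    then show ?case by (auto simp: fun_eq_iff restrict_def)
  next
    case (4 nu)
    show ?case
    proof (rule restrict_PiE_iff[THEN iffD2], rule ballI)
      fix j assume j: "j \<in> {1..n}"
      then have r: "n + 1 - j \<in> {1..n}" by auto
      have e: "?N + 1 - Suc (n + 1 - j) = j" "?N + 1 - (n + 1 - j) = Suc j" using j by auto
      from interlacingD[OF 4 r] have "nat (k j) \<le> nu (n + 1 - j)" "nu (n + 1 - j) \<le> nat (k (Suc j))"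
        unfolding e by auto
      moreover have "0 \<le> k j" "0 \<le> k (Suc j)" using Suc.prems(1) j by auto
      ultimately show "int (nu (n + 1 - j)) \<in> {k j..k (Suc j)}" by auto
    qed
  next
    case (5 l)
    let ?nu = "restrict (\<lambda>r. nat (l (n + 1 - r))) {1..n}"
    have l: "k j \<le> l j \<and> l j \<le> k (Suc j)" if "j \<in> {1..n}" for j using that 5 by (auto simp: PiE_def Pi_def)
    have l0: "0 \<le> l j" if "j \<in> {1..n}" for j using l[OF that] Suc.prems(1)[of j] that by auto
    have "int (?mu r) = k (?N + 1 - r)" if "r \<in> {1..?N}" for r
    proof -
      have "?N + 1 - r \<in> {1..?N}" using that by auto
      from Suc.prems(1)[OF this] show ?thesis by simp
    qed
    then have "int (\<Sum>r=1..?N. ?mu r) = (\<Sum>r=1..?N. k (?N + 1 - r))"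
      unfolding of_nat_sum by (rule sum.cong[OF refl])
    moreover have "int (?nu r) = l (n + 1 - r)" if "r \<in> {1..n}" for r
    proof -
      have "n + 1 - r \<in> {1..n}" using that by auto
      from l0[OF this] that show ?thesis by simp
    qed
    then have "int (\<Sum>r=1..n. ?nu r) = (\<Sum>r=1..n. l (n + 1 - r))"
      unfolding of_nat_sum by (rule sum.cong[OF refl])
    ultimately have e: "(\<Sum>j=1..?N. k j) - (\<Sum>j=1..n. l j) = int (\<Sum>r=1..?N. ?mu r) - int (\<Sum>r=1..n. ?nu r)"
      using rev[of k ?N] rev[of l n] by (simp del: sum.cl_ivl_Suc)
    \<comment> \<open>The exponent in the branching rule is a difference of naturals; this bound
      shows that it is not truncated.\<close>
    have "(\<Sum>j=1..n. l j) \<le> (\<Sum>j=1..n. k (Suc j))" using l by (intro sum_mono) auto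
    also have "\<dots> = (\<Sum>j=Suc 1..?N. k j)" by (simp only: sum.atLeast_Suc_atMost_Suc_shift o_def)
    also have "\<dots> \<le> (\<Sum>j=1..?N. k j)" using Suc.prems(1)[of 1] by (simp add: sum.atLeast_Suc_atMost)
    finally have "(\<Sum>r=1..n. ?nu r) \<le> (\<Sum>r=1..?N. ?mu r)" using e by linarith
    then have "X ?N powi ((\<Sum>j=1..?N. k j) - (\<Sum>j=1..n. l j)) = X ?N ^ ((\<Sum>r=1..?N. ?mu r) - (\<Sum>r=1..n. ?nu r))"
      unfolding e by (simp only: of_nat_diff[symmetric] power_int_of_nat)
    moreover have "schur n (\<lambda>r. nat (l (n + 1 - r))) X = schur n ?nu X"
      by (rule schur_cong) auto
    ultimately show ?case by simp
  qed
  also have "\<dots> = schur ?N ?mu X" by (rule schur_Suc[OF mu, symmetric])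
  finally show ?case .
qed

section \<open>The sorting permutation of an injective integer sequence\<close>

text \<open>Existence and uniqueness together give access to the \<open>THE\<close> in
  \<open>ext_schur\<close>.\<close>

lemma ex1_sorting_permutation:
  fixes f :: "nat \<Rightarrow> int"
  assumes inj: "inj_on f {1..n}"
  shows "\<exists>!\<sigma>. \<sigma> permutes {1..n} \<and> (\<forall>i j. 1 \<le> i \<and> i < j \<and> j \<le> n \<longrightarrow> f (\<sigma> i) > f (\<sigma> j))"
proof -
  \<comment> \<open>One plus the number of larger values, that is, the place in decreasing order. A
    sorting permutation sends places to elements, so it has to be the inverse of
    \<open>rk\<close>.\<close>
  define rk where "rk = (\<lambda>x. if x \<in> {1..n} then Suc (card {y\<in>{1..n}. f y > f x}) else x)"
  have rk_less: "rk y < rk x" if "x \<in> {1..n}" "y \<in> {1..n}" "f x < f y" for x y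
  proof -
    have "{z\<in>{1..n}. f z > f y} \<subset> {z\<in>{1..n}. f z > f x}" using that by force
    then have "card {z\<in>{1..n}. f z > f y} < card {z\<in>{1..n}. f z > f x}" by (intro psubset_card_mono) auto
    then show ?thesis using that by (simp add: rk_def)
  qed
  have rk_inj: "inj_on rk {1..n}"
  proof (rule inj_onI)
    fix x y assume xy: "x \<in> {1..n}" "y \<in> {1..n}" "rk x = rk y"
    then have "f x = f y" using rk_less[of x y] rk_less[of y x] by (cases "f x" "f y" rule: linorder_cases) auto
    then show "x = y" using inj xy by (auto dest: inj_onD)
  qed
  have "rk x \<in> {1..n}" if "x \<in> {1..n}" for x
  proof -
    have "{y\<in>{1..n}. f y > f x} \<subseteq> {1..n} - {x}" by blast
    then have "{y\<in>{1..n}. f y > f x} \<subset> {1..n}" using that by blast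
    then have "card {y\<in>{1..n}. f y > f x} < card {1..n}" by (intro psubset_card_mono) auto
    then show ?thesis using that by (simp add: rk_def)
  qed
  then have "rk ` {1..n} = {1..n}" using endo_inj_surj[OF finite_atLeastAtMost _ rk_inj] by blast
  then have rk_perm: "rk permutes {1..n}"
    using rk_inj by (intro bij_imp_permutes) (auto simp: bij_betw_def rk_def)
  have ex: "inv rk permutes {1..n}" using rk_perm by (rule permutes_inv)
  have dec_rk: "f (inv rk i) > f (inv rk j)" if ij: "1 \<le> i" "i < j" "j \<le> n" for i j
  proof (rule ccontr)
    assume "\<not> ?thesis"
    moreover have "inv rk i \<in> {1..n}" "inv rk j \<in> {1..n}"
      using permutes_in_image[OF ex] ij by auto
    moreover have "rk (inv rk i) = i" "rk (inv rk j) = j" using permutes_inverses(1)[OF rk_perm] by auto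
    ultimately show False using rk_less[of "inv rk i" "inv rk j"] ij inj
      by (metis inj_onD less_asym linorder_neqE not_less_iff_gr_or_eq)
  qed
  have uniq: "\<sigma> = inv rk" if s: "\<sigma> permutes {1..n}" and
    dec: "\<And>i j. 1 \<le> i \<Longrightarrow> i < j \<Longrightarrow> j \<le> n \<Longrightarrow> f (\<sigma> i) > f (\<sigma> j)" for \<sigma>
  proof -
    have "rk (\<sigma> i) = i" for i
    proof (cases "i \<in> {1..n}")
      case True
      have "{y\<in>{1..n}. f y > f (\<sigma> i)} = \<sigma> ` {1..<i}"
      proof (intro set_eqI iffI)
        fix y assume y: "y \<in> {y\<in>{1..n}. f y > f (\<sigma> i)}"
        then have "y \<in> \<sigma> ` {1..n}" using permutes_image[OF s] by auto
        then obtain j where j: "y = \<sigma> j" "j \<in> {1..n}" by auto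
        then have "j < i" using y True dec[of i j] by (cases i j rule: linorder_cases) auto
        then show "y \<in> \<sigma> ` {1..<i}" using j by auto
      next
        fix y assume "y \<in> \<sigma> ` {1..<i}"
        then obtain j where "y = \<sigma> j" "1 \<le> j" "j < i" by auto
        then show "y \<in> {y\<in>{1..n}. f y > f (\<sigma> i)}"
          using dec[of j i] permutes_in_image[OF s, of j] True by auto
      qed
      moreover have "card (\<sigma> ` {1..<i}) = i - 1"
        using permutes_inj_on[OF s] by (simp add: card_image)
      moreover have "\<sigma> i \<in> {1..n}" using permutes_in_image[OF s] True by simp
      ultimately show ?thesis using True by (simp add: rk_def)
    next
      case False
      then have "\<sigma> i = i" using s by (simp add: permutes_def)
      then show ?thesis by (simp only: rk_def False if_False)
    qed
    then have "\<sigma> i = inv rk i" for i using permutes_inverses(2)[OF rk_perm, of "\<sigma> i"] by simp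
    then show ?thesis by blast
  qed
  show ?thesis
  proof (rule ex1I)
    show "inv rk permutes {1..n} \<and> (\<forall>i j. 1 \<le> i \<and> i < j \<and> j \<le> n \<longrightarrow> f (inv rk i) > f (inv rk j))"
      using ex dec_rk by blast
  qed (use uniq in blast)
qed

subsection \<open>The operator formula up to the Vandermonde factor\<close>

context int_powers
begin

text \<open>Jacobi's bialternant formula, since trivial weights make every W factor equal to
  1.\<close>

lemma vand_ggf1:
  "vand P n * ggf1 P n k = alt_sum n (\<lambda>\<sigma>. \<Prod>i=1..n. P (\<sigma> i) (k i + int i - 1))"
  by (simp add: vand_ggf opW_def case_prod_beta)

text \<open>Two equal exponents are two equal columns of the alternant.\<close>

lemma vand_ggf1_eq_0:
  assumes ij: "1 \<le> i" "i < j" "j \<le> n" and eq: "k i + int i = k j + int j"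
  shows "vand P n * ggf1 P n k = 0"
  unfolding vand_ggf1
proof (rule alt_sum_eq_0)
  show "i \<in> {1..n}" "j \<in> {1..n}" "i \<noteq> j" using ij by auto
  fix \<sigma> :: "nat \<Rightarrow> nat"
  let ?t = "transpose i j"
  have t: "?t permutes {1..n}" using ij by (intro permutes_swap_id) auto
  have b: "k (?t m) + int (?t m) = k m + int m" for m using eq by (simp add: transpose_def)
  have "(\<Prod>m=1..n. P (\<sigma> m) (k m + int m - 1)) = (\<Prod>m=1..n. P (\<sigma> (?t m)) (k (?t m) + int (?t m) - 1))"
    using prod.permute[OF t, of "\<lambda>m. P (\<sigma> m) (k m + int m - 1)"] by (simp add: o_def)
  then show "(\<Prod>m=1..n. P ((\<sigma> \<circ> ?t) m) (k m + int m - 1)) = (\<Prod>m=1..n. P (\<sigma> m) (k m + int m - 1))"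
    by (simp add: b)
qed

text \<open>The straightening rule: the exponents \<open>k' i + i\<close> are those of
  \<open>k\<close> permuted by \<open>\<pi>\<close> and raised by \<open>p\<close>, so the columns
  of the alternant are permuted and each variable contributes its power \<open>p\<close>.\<close>

lemma vand_ggf1_permute:
  assumes \<pi>: "\<pi> permutes {1..n}"
    and k': "\<And>i. i \<in> {1..n} \<Longrightarrow> k' i = k (\<pi> i) + int (\<pi> i) - int i + p"
  shows "vand P n * ggf1 P n k' = vand P n * (of_int (sign \<pi>) * (\<Prod>i=1..n. P i p) * ggf1 P n k)"
proof -
  let ?F = "\<lambda>\<sigma>. \<Prod>i=1..n. P (\<sigma> i) (k i + int i - 1)"
  let ?p = "\<Prod>i=1..n. P i p"
  have perm: "permutation \<tau>" if "\<tau> permutes {1..n}" for \<tau>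
    using that by (meson finite_atLeastAtMost permutation_permutes)
  have F: "(\<Prod>i=1..n. P ((\<sigma> \<circ> \<pi>) i) (k' i + int i - 1)) = ?p * ?F \<sigma>" if \<sigma>: "\<sigma> permutes {1..n}" for \<sigma>
  proof -
    have "(\<Prod>i=1..n. P ((\<sigma> \<circ> \<pi>) i) (k' i + int i - 1)) =
        (\<Prod>i=1..n. P (\<sigma> (\<pi> i)) p * P (\<sigma> (\<pi> i)) (k (\<pi> i) + int (\<pi> i) - 1))"
      by (rule prod.cong[OF refl]) (auto simp: k' algebra_simps simp flip: P_add)
    also have "\<dots> = (\<Prod>i=1..n. P (\<sigma> i) p * P (\<sigma> i) (k i + int i - 1))"
      using prod.permute[OF \<pi>, of "\<lambda>i. P (\<sigma> i) p * P (\<sigma> i) (k i + int i - 1)"] by (simp add: o_def)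
    also have "\<dots> = (\<Prod>i=1..n. P (\<sigma> i) p) * ?F \<sigma>" by (rule prod.distrib)
    also have "(\<Prod>i=1..n. P (\<sigma> i) p) = ?p"
      using prod.permute[OF \<sigma>, of "\<lambda>i. P i p"] by (simp add: o_def)
    finally show ?thesis .
  qed
  have "vand P n * ggf1 P n k' = (\<Sum>\<sigma> | \<sigma> permutes {1..n}. of_int (sign (\<sigma> \<circ> \<pi>)) * (\<Prod>i=1..n. P ((\<sigma> \<circ> \<pi>) i) (k' i + int i - 1)))"
    unfolding vand_ggf1 alt_sum_def by (rule sum_permutations_compose_right[OF \<pi>])
  also have "\<dots> = (\<Sum>\<sigma> | \<sigma> permutes {1..n}. of_int (sign \<pi>) * ?p * (of_int (sign \<sigma>) * ?F \<sigma>))"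
  proof (rule sum.cong[OF refl])
    fix \<sigma> assume "\<sigma> \<in> {\<sigma>. \<sigma> permutes {1..n}}"
    then have \<sigma>: "\<sigma> permutes {1..n}" by simp
    have "sign (\<sigma> \<circ> \<pi>) = sign \<sigma> * sign \<pi>" using \<sigma> \<pi> by (intro sign_compose perm)
    then show "of_int (sign (\<sigma> \<circ> \<pi>)) * (\<Prod>i=1..n. P ((\<sigma> \<circ> \<pi>) i) (k' i + int i - 1)) =
        of_int (sign \<pi>) * ?p * (of_int (sign \<sigma>) * ?F \<sigma>)"
      unfolding F[OF \<sigma>] by (simp only: of_int_mult mult_ac)
  qed
  also have "\<dots> = of_int (sign \<pi>) * ?p * (vand P n * ggf1 P n k)"
    unfolding vand_ggf1 alt_sum_def by (rule sum_distrib_left[symmetric])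
  finally show ?thesis by (simp only: mult_ac)
qed

text \<open>Monomials are eigenvectors of the shift operators, and a choice of shifts multiplies the
  monomial by the corresponding terms of the symbols.\<close>

lemma prod_shifted:
  "(\<Prod>i=1..n. P (\<sigma> i) (shifted n c k i + int i - 1)) = (\<Prod>i=1..n. P (\<sigma> i) (k i + int i - 1)) *
     (\<Prod>(p,q)\<in>pairs_lt n. P (\<sigma> p) (snd (c (p,q))) * P (\<sigma> q) (- fst (c (p,q))))"
proof -
  have "(\<Prod>i=1..n. P (\<sigma> i) (shifted n c k i + int i - 1)) = (\<Prod>i=1..n. P (\<sigma> i) (k i + int i - 1) *
     ((\<Prod>q\<in>{i<..n}. P (\<sigma> i) (snd (c (i,q)))) * (\<Prod>p\<in>{1..<i}. P (\<sigma> i) (- fst (c (p,i))))))"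
  proof (rule prod.cong[OF refl])
    fix i
    have "shifted n c k i + int i - 1 = (k i + int i - 1) + ((\<Sum>q\<in>{i<..n}. snd (c (i,q))) + (\<Sum>p\<in>{1..<i}. - fst (c (p,i))))"
      by (simp add: shifted_def sum_negf)
    then show "P (\<sigma> i) (shifted n c k i + int i - 1) = P (\<sigma> i) (k i + int i - 1) *
     ((\<Prod>q\<in>{i<..n}. P (\<sigma> i) (snd (c (i,q)))) * (\<Prod>p\<in>{1..<i}. P (\<sigma> i) (- fst (c (p,i)))))"
      by (simp only: P_add P_sum)
  qed
  moreover have "(\<Prod>i=1..n. \<Prod>q\<in>{i<..n}. P (\<sigma> i) (snd (c (i,q)))) = (\<Prod>(p,q)\<in>pairs_lt n. P (\<sigma> p) (snd (c (p,q))))"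
    by (subst prod.Sigma) (auto simp: pairs_lt_def intro!: prod.cong)
  moreover have "(\<Prod>i=1..n. \<Prod>p\<in>{1..<i}. P (\<sigma> i) (- fst (c (p,i)))) = (\<Prod>(p,q)\<in>pairs_lt n. P (\<sigma> q) (- fst (c (p,q))))"
    by (subst prod.Sigma, simp, simp, rule prod.reindex_bij_witness[where i = prod.swap and j = prod.swap])
       (auto simp: pairs_lt_def)
  ultimately show ?thesis by (simp only: prod.distrib case_prod_beta')
qed

lemma finite_pairs_lt [simp]: "finite (pairs_lt n)"
  by (rule finite_subset[of _ "{1..n} \<times> {1..n}"]) (auto simp: pairs_lt_def)

text \<open>By \<open>prod_shifted\<close>, summing over all choices rebuilds the product of W over
  p < q inside each alternant term, which turns the trivially weighted bialternant into the general
  one.\<close>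

lemma vand_ggf_operator:
  assumes S: "finite S"
  shows "vand P n * ggf S w P n k = vand P n * ((\<Prod>i=1..n. opW S w P i i) *
     (\<Sum>c\<in>PiE (pairs_lt n) (\<lambda>_. S). (\<Prod>pq\<in>pairs_lt n. w (fst (c pq)) (snd (c pq))) * ggf1 P n (shifted n c k)))"
proof -
  let ?C = "PiE (pairs_lt n) (\<lambda>_. S)" and ?W = "opW S w P"
  let ?wt = "\<lambda>c. \<Prod>pq\<in>pairs_lt n. w (fst (c pq)) (snd (c pq))"
  have "vand P n * ((\<Prod>i=1..n. ?W i i) * (\<Sum>c\<in>?C. ?wt c * ggf1 P n (shifted n c k))) =
      (\<Prod>i=1..n. ?W i i) * (\<Sum>c\<in>?C. ?wt c * (vand P n * ggf1 P n (shifted n c k)))"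
    by (simp only: sum_distrib_left mult_ac)
  also have "\<dots> = alt_sum n (\<lambda>\<sigma>. (\<Prod>i=1..n. ?W i i) * (\<Sum>c\<in>?C. ?wt c * (\<Prod>i=1..n. P (\<sigma> i) (shifted n c k i + int i - 1))))"
    unfolding vand_ggf1 alt_sum_mult_left alt_sum_sum ..
  also have "\<dots> = alt_sum n (\<lambda>\<sigma>. (\<Prod>i=1..n. P (\<sigma> i) (k i + int i - 1)) * (\<Prod>(p,q)\<in>pairs_le n. ?W (\<sigma> p) (\<sigma> q)))"
  proof (rule alt_sum_cong)
    fix \<sigma> assume \<sigma>: "\<sigma> permutes {1..n}"
    have "(\<Sum>c\<in>?C. ?wt c * (\<Prod>i=1..n. P (\<sigma> i) (shifted n c k i + int i - 1))) =
       (\<Prod>i=1..n. P (\<sigma> i) (k i + int i - 1)) * (\<Sum>c\<in>?C. \<Prod>pq\<in>pairs_lt n. w (fst (c pq)) (snd (c pq)) *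
          (P (\<sigma> (fst pq)) (snd (c pq)) * P (\<sigma> (snd pq)) (- fst (c pq))))"
      unfolding prod_shifted prod.distrib sum_distrib_left case_prod_beta' by (simp only: mult_ac prod.collapse)
    also have "(\<Sum>c\<in>?C. \<Prod>pq\<in>pairs_lt n. w (fst (c pq)) (snd (c pq)) *
          (P (\<sigma> (fst pq)) (snd (c pq)) * P (\<sigma> (snd pq)) (- fst (c pq)))) = (\<Prod>pq\<in>pairs_lt n. ?W (\<sigma> (fst pq)) (\<sigma> (snd pq)))"
      unfolding opW_def case_prod_beta' by (rule prod_sum_PiE[symmetric]) (auto simp: S)
    \<comment> \<open>The diagonal product is symmetric, which is why it stands outside the
      alternating sum as a plain factor.\<close>
    also have "(\<Prod>i=1..n. ?W i i) = (\<Prod>i=1..n. ?W (\<sigma> i) (\<sigma> i))"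
      using prod.permute[OF \<sigma>, of "\<lambda>i. ?W i i"] by (simp add: o_def)
    moreover have "(\<Prod>(p,q)\<in>pairs_le n. ?W (\<sigma> p) (\<sigma> q)) = (\<Prod>i=1..n. ?W (\<sigma> i) (\<sigma> i)) * (\<Prod>pq\<in>pairs_lt n. ?W (\<sigma> (fst pq)) (\<sigma> (snd pq)))"
    proof -
      have "pairs_le n = (\<lambda>i. (i,i)) ` {1..n} \<union> pairs_lt n" by (auto simp: pairs_le_def pairs_lt_def)
      then have "(\<Prod>(p,q)\<in>pairs_le n. ?W (\<sigma> p) (\<sigma> q)) = (\<Prod>(p,q)\<in>(\<lambda>i. (i,i)) ` {1..n}. ?W (\<sigma> p) (\<sigma> q)) * (\<Prod>(p,q)\<in>pairs_lt n. ?W (\<sigma> p) (\<sigma> q))"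
        by (simp only:) (rule prod.union_disjoint[OF finite_imageI finite_pairs_lt], auto simp: pairs_lt_def)
      then show ?thesis by (simp add: prod.reindex inj_on_def case_prod_beta')
    qed
    ultimately show "(\<Prod>i=1..n. ?W i i) * (\<Sum>c\<in>?C. ?wt c * (\<Prod>i=1..n. P (\<sigma> i) (shifted n c k i + int i - 1))) =
       (\<Prod>i=1..n. P (\<sigma> i) (k i + int i - 1)) * (\<Prod>(p,q)\<in>pairs_le n. ?W (\<sigma> p) (\<sigma> q))"
      by (simp only: mult_ac)
  qed
  finally show ?thesis unfolding vand_ggf[OF S] ..
qed

end

subsection \<open>Cancelling the Vandermonde factor\<close>

text \<open>Power series do not form a field, so the laws of exponents are restricted to units, the
  series with nonzero constant term. Writing the exponent as any difference of naturals reduces the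
  addition law to natural powers.\<close>

lemma fps_power_int_diff:
  fixes x :: "'a::field fps"
  assumes "fps_nth x 0 \<noteq> 0"
  shows "x powi (int m - int n) = x ^ m * inverse x ^ n"
proof -
  have inv: "x * inverse x = 1" by (rule inverse_mult_eq_1'[OF assms])
  show ?thesis
  proof (cases "n \<le> m")
    case True
    then have "x ^ m * inverse x ^ n = x ^ (m - n) * (x * inverse x) ^ n"
      by (simp add: power_mult_distrib flip: mult.assoc power_add)
    then show ?thesis using True by (simp add: inv power_int_def nat_diff_distrib)
  next
    case False
    then have "x ^ m * inverse x ^ n = inverse x ^ (n - m) * (x * inverse x) ^ m"
      by (simp add: power_mult_distrib mult.left_commute[of "inverse x ^ (n - m)"] flip: power_add)
    then show ?thesis using False by (simp add: inv power_int_def nat_diff_distrib)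
  qed
qed

lemma fps_power_int_add:
  fixes x :: "'a::field fps"
  assumes "fps_nth x 0 \<noteq> 0"
  shows "x powi (a + b) = x powi a * x powi b"
proof -
  have d: "e = int (nat e) - int (nat (- e))" for e by simp
  have "a + b = int (nat a + nat b) - int (nat (- a) + nat (- b))" by simp
  then have "x powi (a + b) = x ^ (nat a + nat b) * inverse x ^ (nat (- a) + nat (- b))"
    by (simp only: fps_power_int_diff[OF assms])
  also have "\<dots> = (x ^ nat a * inverse x ^ nat (- a)) * (x ^ nat b * inverse x ^ nat (- b))"
    by (simp only: power_add mult_ac)
  also have "\<dots> = x powi a * x powi b"
    \<comment> \<open>The third occurrence of each exponent is the one under \<open>powi\<close>;
      the first two stand inside \<open>nat\<close>.\<close>
    by (subst (3) d[of a], subst (3) d[of b]) (simp only: fps_power_int_diff[OF assms])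
  finally show ?thesis .
qed

lemma fps_power_int_nth_0:
  fixes x :: "'a::field fps"
  shows "fps_nth (x powi e) 0 = fps_nth x 0 powi e"
  by (simp add: power_int_def fps_nth_power_0 fps_inverse_def)

lemma fps_nth_0_prod: "fps_nth (\<Prod>i\<in>A. f i) 0 = (\<Prod>i\<in>A. fps_nth (f i :: 'a::comm_ring_1 fps) 0)"
  by (induction A rule: infinite_finite_induct) auto

lemma fps_nth_0_of_int: "fps_nth (of_int z :: 'a::comm_ring_1 fps) 0 = of_int z"
  by (simp flip: fps_of_int)

text \<open>Taking constant terms is a ring homomorphism, and \<open>ggf\<close> is a polynomial in
  the weights and in the values of \<open>P\<close>.\<close>

lemma ggf_nth_0:
  assumes "\<And>i e. i \<in> {1..n} \<Longrightarrow> fps_nth (P i e) 0 = Q i e"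
  shows "fps_nth (ggf S (\<lambda>s t. fps_const (w s t)) P n k) 0 = ggf S w Q n k"
  using assms
proof (induction n arbitrary: k)
  case (Suc n)
  have IH: "fps_nth (ggf S (\<lambda>s t. fps_const (w s t)) P n l) 0 = ggf S w Q n l" for l
    using Suc.prems by (intro Suc.IH) auto
  have P: "fps_nth (P (Suc n) e) 0 = Q (Suc n) e" for e using Suc.prems by simp
  show ?case
    unfolding ggf.simps fps_sum_nth fps_mult_nth_0 fps_nth_0_prod fps_nth_0_of_int IH P
    by (simp only: fps_nth_fps_const if_P[OF refl])
qed simp

text \<open>Distinct unit power series with prescribed constant terms: identities proved up to the
  factor \<open>vand\<close> descend to arbitrary nonzero values in any field.\<close>

definition perturb :: "nat \<Rightarrow> (nat \<Rightarrow> 'a::field) \<Rightarrow> nat \<Rightarrow> 'a fps" where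
  "perturb n X i = (if i \<in> {1..n} then fps_const (X i) + fps_X ^ i else 1)"

definition ppow :: "nat \<Rightarrow> (nat \<Rightarrow> 'a::field) \<Rightarrow> nat \<Rightarrow> int \<Rightarrow> 'a fps" where
  "ppow n X i e = perturb n X i powi e"

section \<open>Identities at arbitrary nonzero field values\<close>

context
  fixes X :: "nat \<Rightarrow> 'a::field" and n :: nat
  assumes X: "\<forall>i\<in>{1..n}. X i \<noteq> 0"
begin

lemma perturb_nth_0: "fps_nth (perturb n X i) 0 = (if i \<in> {1..n} then X i else 1)"
  by (simp add: perturb_def)

text \<open>The locale axioms range over all indices; the value 1 of \<open>perturb\<close> outside
  \<open>{1..n}\<close> keeps those series units as well.\<close>

lemma int_powers_ppow: "int_powers (ppow n X)"
proof
  have "fps_nth (perturb n X i) 0 \<noteq> 0" for i using X by (simp add: perturb_nth_0)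
  then show "ppow n X i (a + b) = ppow n X i a * ppow n X i b" for i a b
    unfolding ppow_def by (rule fps_power_int_add)
qed (simp add: ppow_def)

lemma ppow_nth_0: "i \<in> {1..n} \<Longrightarrow> fps_nth (ppow n X i e) 0 = X i powi e"
  by (simp add: ppow_def fps_power_int_nth_0 perturb_nth_0)

lemma vand_ppow_nonzero: "vand (ppow n X) n \<noteq> 0"
proof -
  have "ppow n X j 1 - ppow n X i 1 \<noteq> 0" if "1 \<le> i" "i < j" "j \<le> n" for i j
  proof -
    \<comment> \<open>At the smaller index \<open>i\<close>, which is positive, neither the constant
      terms nor the monomial of degree \<open>j\<close> contributes.\<close>
    have "fps_nth (ppow n X j 1 - ppow n X i 1) i = - 1"
      using that by (simp add: ppow_def power_int_def perturb_def)
    then show ?thesis by auto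
  qed
  then show ?thesis by (auto simp: vand_def)
qed

lemma nth_0_eq:
  assumes "vand (ppow n X) n * A = vand (ppow n X) n * B"
  shows "fps_nth A 0 = fps_nth B 0"
  using assms vand_ppow_nonzero by simp

lemma ggf1_nth_0: "fps_nth (ggf1 (ppow n X) n k) 0 = ggf1 (\<lambda>i e. X i powi e) n k"
  using ggf_nth_0[OF ppow_nth_0, where w = "\<lambda>_ _. 1"] by simp

lemma ggf1_eq_0:
  assumes "1 \<le> i" "i < j" "j \<le> n" "k i + int i = k j + int j"
  shows "ggf1 (\<lambda>i e. X i powi e) n k = 0"
proof -
  interpret int_powers "ppow n X" by (rule int_powers_ppow)
  from vand_ggf1_eq_0[where k = k, OF assms] have "fps_nth (ggf1 (ppow n X) n k) 0 = fps_nth 0 0"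
    by (intro nth_0_eq) simp
  then show ?thesis by (simp add: ggf1_nth_0)
qed

lemma ggf1_permute:
  assumes "\<pi> permutes {1..n}"
    and "\<And>i. i \<in> {1..n} \<Longrightarrow> k' i = k (\<pi> i) + int (\<pi> i) - int i + p"
  shows "ggf1 (\<lambda>i e. X i powi e) n k' = of_int (sign \<pi>) * (\<Prod>i=1..n. X i powi p) * ggf1 (\<lambda>i e. X i powi e) n k"
proof -
  interpret int_powers "ppow n X" by (rule int_powers_ppow)
  have "fps_nth (ggf1 (ppow n X) n k') 0 = fps_nth (of_int (sign \<pi>) * (\<Prod>i=1..n. ppow n X i p) * ggf1 (ppow n X) n k) 0"
    by (rule nth_0_eq[OF vand_ggf1_permute[OF assms]])
  moreover have "(\<Prod>i=1..n. fps_nth (ppow n X i p) 0) = (\<Prod>i=1..n. X i powi p)"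
    by (rule prod.cong) (simp_all add: ppow_nth_0)
  ultimately show ?thesis
    by (simp only: fps_mult_nth_0 fps_nth_0_prod fps_nth_0_of_int ggf1_nth_0)
qed

lemma ggf_operator:
  assumes S: "finite S"
  shows "ggf S w (\<lambda>i e. X i powi e) n k = (\<Prod>i=1..n. opW S w (\<lambda>i e. X i powi e) i i) *
     (\<Sum>c\<in>PiE (pairs_lt n) (\<lambda>_. S). (\<Prod>pq\<in>pairs_lt n. w (fst (c pq)) (snd (c pq))) *
        ggf1 (\<lambda>i e. X i powi e) n (shifted n c k))"
proof -
  interpret int_powers "ppow n X" by (rule int_powers_ppow)
  let ?w = "\<lambda>s t. fps_const (w s t)"
  have "fps_nth (ggf S ?w (ppow n X) n k) 0 = fps_nth ((\<Prod>i=1..n. opW S ?w (ppow n X) i i) *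
     (\<Sum>c\<in>PiE (pairs_lt n) (\<lambda>_. S). (\<Prod>pq\<in>pairs_lt n. ?w (fst (c pq)) (snd (c pq))) *
        ggf1 (ppow n X) n (shifted n c k))) 0"
    by (rule nth_0_eq[OF vand_ggf_operator[OF S]])
  moreover have "(\<Prod>i=1..n. fps_nth (opW S ?w (ppow n X) i i) 0) = (\<Prod>i=1..n. opW S w (\<lambda>i e. X i powi e) i i)"
    by (rule prod.cong) (auto simp: opW_def fps_sum_nth case_prod_beta' ppow_nth_0)
  moreover have "fps_nth (ggf S ?w (ppow n X) n k) 0 = ggf S w (\<lambda>i e. X i powi e) n k"
    by (rule ggf_nth_0[OF ppow_nth_0])
  ultimately show ?thesis
    by (simp add: fps_sum_nth fps_nth_0_prod ggf1_nth_0)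
qed

text \<open>\<open>ggf1\<close> obeys the two rules by which \<open>ext_schur\<close> is defined,
  vanishing and straightening, and agrees with \<open>schur\<close> on partitions.\<close>

lemma ext_schur_eq_ggf1: "ext_schur n (\<lambda>i. k (n + 1 - i)) X = ggf1 (\<lambda>i e. X i powi e) n k"
proof -
  let ?Q = "\<lambda>i e. X i powi e"
  define lam where "lam = (\<lambda>i. k (n + 1 - i))"
  define f where "f = (\<lambda>i. lam i - int i)"
  show ?thesis
  proof (cases "\<exists>i j. 1 \<le> i \<and> i < j \<and> j \<le> n \<and> lam i - int i = lam j - int j")
    case True
    then obtain i j where ij: "1 \<le> i" "i < j" "j \<le> n" "lam i - int i = lam j - int j" by blast
    \<comment> \<open>Under index reversal \<open>lam i - i\<close> becomes \<open>k m + m\<close>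
      at \<open>m = n + 1 - i\<close>, up to the constant \<open>n + 1\<close>.\<close>
    have "ggf1 ?Q n k = 0"
      by (rule ggf1_eq_0[of "n + 1 - j" "n + 1 - i"]) (use ij in \<open>auto simp: lam_def of_nat_diff\<close>)
    then show ?thesis using True by (simp add: ext_schur_def lam_def)
  next
    case False
    have "inj_on f {1..n}"
      by (rule linorder_inj_onI) (use False in \<open>auto simp: f_def\<close>)
    note ex1 = ex1_sorting_permutation[OF this]
    define \<sigma> where "\<sigma> = (THE \<sigma>. \<sigma> permutes {1..n} \<and> (\<forall>i j. 1 \<le> i \<and> i < j \<and> j \<le> n \<longrightarrow> f (\<sigma> i) > f (\<sigma> j)))"
    have \<sigma>: "\<sigma> permutes {1..n}" and dec: "\<And>i j. 1 \<le> i \<Longrightarrow> i < j \<Longrightarrow> j \<le> n \<Longrightarrow> f (\<sigma> i) > f (\<sigma> j)"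
      using theI'[OF ex1] unfolding \<sigma>_def[symmetric] by auto
    define p where "p = max 0 (- (lam (\<sigma> n) + int n - int (\<sigma> n)))"
    define mu where "mu = (\<lambda>i. nat (lam (\<sigma> i) + int i - int (\<sigma> i) + p))"
    have ext: "ext_schur n lam X = of_int (sign \<sigma>) * schur n mu X * (\<Prod>i=1..n. X i powi (- p))"
      unfolding ext_schur_def Let_def if_not_P[OF False] mu_def p_def \<sigma>_def f_def ..
    \<comment> \<open>\<open>\<sigma>\<close> sorts \<open>lam\<close>, which reads \<open>k\<close>
      backwards; conjugation by the reversal transports it to \<open>k\<close> without changing the
      sign.\<close>
    define \<rho> where "\<rho> = (\<lambda>i. if i \<in> {1..n} then n + 1 - i else i)"
    have \<rho>\<rho>: "\<rho> (\<rho> i) = i" for i by (auto simp: \<rho>_def)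
    have \<rho>_mem: "\<rho> i \<in> {1..n}" if "i \<in> {1..n}" for i using that by (auto simp: \<rho>_def)
    have \<rho>: "\<rho> permutes {1..n}"
      unfolding permutes_def by (metis \<rho>_def \<rho>\<rho>)
    define \<pi> where "\<pi> = \<rho> \<circ> \<sigma> \<circ> \<rho>"
    have \<pi>: "\<pi> permutes {1..n}" unfolding \<pi>_def using \<sigma> \<rho> by (intro permutes_compose)
    have perm: "permutation \<tau>" if "\<tau> permutes {1..n}" for \<tau>
      using that by (meson finite_atLeastAtMost permutation_permutes)
    have "sign \<pi> = sign \<rho> * sign \<sigma> * sign \<rho>"
      unfolding \<pi>_def using \<sigma> \<rho> by (simp add: sign_compose perm permutation_compose)
    then have sign: "sign \<pi> = sign \<sigma>" by (simp add: mult_ac)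
    define k' where "k' = (\<lambda>i. k (\<pi> i) + int (\<pi> i) - int i + p)"
    have k'_rev: "k' (n + 1 - i) = lam (\<sigma> i) + int i - int (\<sigma> i) + p" if i: "i \<in> {1..n}" for i
    proof -
      have "\<sigma> i \<in> {1..n}" using permutes_in_image[OF \<sigma>] i by simp
      moreover have "\<pi> (n + 1 - i) = \<rho> (\<sigma> i)" using i \<rho>\<rho>[of i] by (simp add: \<pi>_def \<rho>_def)
      ultimately show ?thesis using i by (auto simp: k'_def lam_def \<rho>_def of_nat_diff)
    qed
    \<comment> \<open>Strictly decreasing integers drop by at least 1 per step, so adding the index
      leaves a weakly decreasing sequence.\<close>
    have gap: "f (\<sigma> j) + int j \<le> f (\<sigma> i) + int i" if "1 \<le> i" "i \<le> j" "j \<le> n" for i j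
      using that(2,3)
    proof (induction j rule: dec_induct)
      case (step j)
      then have "f (\<sigma> (Suc j)) < f (\<sigma> j)" using that(1) by (intro dec) auto
      with step show ?case by simp
    qed simp
    have k'_f: "k' j = f (\<sigma> (n + 1 - j)) + int (n + 1 - j) + p" if "j \<in> {1..n}" for j
    proof -
      have "n + 1 - j \<in> {1..n}" "n + 1 - (n + 1 - j) = j" using that by auto
      then show ?thesis using k'_rev[of "n + 1 - j"] by (simp add: f_def)
    qed
    have "ggf1 ?Q n k' = schur n (\<lambda>r. nat (k' (n + 1 - r))) X"
    proof (rule ggf1_eq_schur)
      fix j assume j: "j \<in> {1..n}"
      \<comment> \<open>\<open>p\<close> is chosen to make the smallest part nonnegative; by
        \<open>gap\<close> all other parts follow.\<close>
      have "0 \<le> f (\<sigma> n) + int n + p" by (simp add: p_def f_def)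
      also have "\<dots> \<le> k' j" using gap[of "n + 1 - j" n] j by (auto simp: k'_f)
      finally show "0 \<le> k' j" .
    next
      fix j assume j: "j \<in> {1..<n}"
      then have "f (\<sigma> (n + 1 - j)) + int (n + 1 - j) \<le> f (\<sigma> (n + 1 - Suc j)) + int (n + 1 - Suc j)"
        by (intro gap) auto
      then show "k' j \<le> k' (Suc j)" using j by (simp add: k'_f)
    qed
    also have "\<dots> = schur n mu X" by (rule schur_cong) (simp only: k'_rev mu_def)
    finally have schur: "schur n mu X = of_int (sign \<sigma>) * (\<Prod>i=1..n. X i powi p) * ggf1 ?Q n k"
      using ggf1_permute[OF \<pi>, of k' k p] by (simp add: k'_def sign)
    have XX: "(\<Prod>i=1..n. X i powi p) * (\<Prod>i=1..n. X i powi (- p)) = 1"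
      unfolding prod.distrib[symmetric] using X by (intro prod.neutral) (simp add: power_int_minus)
    have ss: "of_int (sign \<sigma>) * of_int (sign \<sigma>) = (1::'a)"
      by (simp flip: of_int_mult)
    have "ext_schur n lam X = (of_int (sign \<sigma>) * of_int (sign \<sigma>)) *
        ((\<Prod>i=1..n. X i powi p) * (\<Prod>i=1..n. X i powi (- p))) * ggf1 ?Q n k"
      unfolding ext schur by (simp only: mult_ac)
    then have "ext_schur n lam X = ggf1 ?Q n k" unfolding ss XX by simp
    then show ?thesis by (simp add: lam_def)
  qed
qed

end

theorem mainTheorem9:
  fixes w :: "int \<Rightarrow> int \<Rightarrow> 'a::field"
    and n :: nat and k :: "nat \<Rightarrow> int" and X :: "nat \<Rightarrow> 'a"
  assumes "finite {(s,t). w s t \<noteq> 0}"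
    and "\<forall>i\<in>{1..n}. X i \<noteq> 0"
  shows "gen_fun w n k X =
    (\<Prod>i=1..n. \<Sum>(s,t)\<in>wsupp w. w s t * X i powi (t - s)) *
    op_apply w n (\<lambda>k'. ext_schur n (\<lambda>i. k' (n + 1 - i)) X) k"
proof -
  have S: "finite (wsupp w)" using assms(1) by (simp add: wsupp_def)
  have "(\<Prod>i=1..n. opW (wsupp w) w (\<lambda>i e. X i powi e) i i) =
      (\<Prod>i=1..n. \<Sum>(s,t)\<in>wsupp w. w s t * X i powi (t - s))"
  proof (rule prod.cong[OF refl])
    fix i assume "i \<in> {1..n}"
    \<comment> \<open>On the diagonal both arguments of W are the same nonzero value, so the two
      powers merge.\<close>
    then have "X i powi t * X i powi (- s) = X i powi (t - s)" for s t
      using assms(2) by (simp flip: power_int_add)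
    then show "opW (wsupp w) w (\<lambda>i e. X i powi e) i i = (\<Sum>(s,t)\<in>wsupp w. w s t * X i powi (t - s))"
      by (simp add: opW_def)
  qed
  then show ?thesis
    unfolding gen_fun_eq_ggf[OF S] ggf_operator[OF assms(2) S] op_apply_def
      ext_schur_eq_ggf1[OF assms(2)] by simp
qed

end
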